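(* For every $r\in\mathbb N$ there exist constants $c>0$, $C>0$ such that for all $f\in\mathbf E$ and all $s>0$, $$c\,\Omega^{r}(s,f)\le K(s^{r},f,\mathbf E,\mathbf E^{r})\le C\big(\Omega^{r}(s,f)+\min(s^{r},1)\|f\|_{\mathbf E}\big).$$
   Context: Let $G=\mathbb R_+\times\mathbb R$ be the "$ax+b$" group with multiplication $(a_1,b_1)(a_2,b_2)=(a_1a_2,\,a_1b_2+b_1)$. Let $T$ be a strongly continuous representation of $G$ in a Banach space $\mathbf E$ with $\|T(g)f\|_{\mathbf E}\le\|f\|_{\mathbf E}$ for all $g,f$. Put $T_1(t)=T(e^{t},0)$, $T_2(t)=T(1,t)$, $t\in\mathbb R$, with (closed) infinitesimal generators $\mathbb A_1,\mathbb A_2$. For $r\in\mathbb N$, $\mathbf E^{r}$ is the space of $f\in\mathbf E$ for which all products $\mathbb A_{j_1}\cdots\mathbb A_{j_k}f$, $1\le k\le r$, $j_i\in\{1,2\}$, are defined, with norm $\|f\|_{\mathbf E^r}=\|f\|_{\mathbf E}+\sum_{k=1}^r\sum_{(j_1,\dots,j_k)\in\{1,2\}^k}\|\mathbb A_{j_1}\cdots\mathbb A_{j_k}f\|_{\mathbf E}$. The mixed modulus of continuity is $$\Omega^{r}(s,f)=\sum_{(j_1,\dots,j_r)\in\{1,2\}^r}\ \sup_{0\le t_{1},\dots,t_{r}\le s}\big\|(T_{j_1}(t_{1})-I)\cdots(T_{j_r}(t_{r})-I)f\big\|_{\mathbf E}.$$ The $K$-functional is $K(t,f,\mathbf E,\mathbf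 E^r)=\inf\{\|f_0\|_{\mathbf E}+t\|f_1\|_{\mathbf E^r}: f=f_0+f_1,\ f_0\in\mathbf E,\ f_1\in\mathbf E^r\}$. *)

theory Defs
  imports "HOL-Analysis.Analysis"
begin

definition axb_group :: "(real \<times> real) set" where
  "axb_group = {g. fst g > 0}"

definition axb_mult :: "real \<times> real \<Rightarrow> real \<times> real \<Rightarrow> real \<times> real" where
  "axb_mult g h = (fst g * fst h, fst g * snd h + snd g)"

definition contr_rep :: "(real \<times> real \<Rightarrow> 'a::banach \<Rightarrow> 'a) \<Rightarrow> bool" where
  "contr_rep T \<longleftrightarrow>
     (\<forall>g\<in>axb_group. bounded_linear (T g)) \<and>
     T (1, 0) = id \<and>
     (\<forall>g\<in>axb_group. \<forall>h\<in>axb_group. T (axb_mult g h) = T g \<circ> T h) \<and>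
     (\<forall>f. continuous_on axb_group (\<lambda>g. T g f)) \<and>
     (\<forall>g\<in>axb_group. \<forall>f. norm (T g f) \<le> norm f)"

definition opgrp :: "(real \<times> real \<Rightarrow> 'a \<Rightarrow> 'a) \<Rightarrow> nat \<Rightarrow> real \<Rightarrow> 'a \<Rightarrow> 'a" where
  "opgrp T j t = (if j = 1 then T (exp t, 0) else T (1, t))"

definition has_gen :: "(real \<Rightarrow> 'a::real_normed_vector \<Rightarrow> 'a) \<Rightarrow> 'a \<Rightarrow> 'a \<Rightarrow> bool" where
  "has_gen S f y \<longleftrightarrow> ((\<lambda>t. (S t f - f) /\<^sub>R t) \<longlongrightarrow> y) (at_right 0)"

fun gen_word :: "(real \<times> real \<Rightarrow> 'a::real_normed_vector \<Rightarrow> 'a) \<Rightarrow> nat list \<Rightarrow> 'a \<Rightarrow> 'a option" where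
  "gen_word T [] f = Some f"
| "gen_word T (j # js) f =
     (case gen_word T js f of
        None \<Rightarrow> None
      | Some y \<Rightarrow> (if (\<exists>z. has_gen (opgrp T j) y z)
                  then Some (THE z. has_gen (opgrp T j) y z) else None))"

definition words :: "nat \<Rightarrow> nat list set" where
  "words k = {js. length js = k \<and> set js \<subseteq> {1, 2}}"

definition Er :: "(real \<times> real \<Rightarrow> 'a::real_normed_vector \<Rightarrow> 'a) \<Rightarrow> nat \<Rightarrow> 'a set" where
  "Er T r = {f. \<forall>k\<in>{1..r}. \<forall>js\<in>words k. gen_word T js f \<noteq> None}"

definition Er_norm :: "(real \<times> real \<Rightarrow> 'a::real_normed_vector \<Rightarrow> 'a) \<Rightarrow> nat \<Rightarrow> 'a \<Rightarrow> real" where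
  "Er_norm T r f = norm f + (\<Sum>k=1..r. \<Sum>js\<in>words k. norm (the (gen_word T js f)))"

fun diff_word :: "(real \<times> real \<Rightarrow> 'a::real_normed_vector \<Rightarrow> 'a) \<Rightarrow> (nat \<times> real) list \<Rightarrow> 'a \<Rightarrow> 'a" where
  "diff_word T [] f = f"
| "diff_word T ((j, t) # ps) f = opgrp T j t (diff_word T ps f) - diff_word T ps f"

definition mixed_modulus :: "(real \<times> real \<Rightarrow> 'a::real_normed_vector \<Rightarrow> 'a) \<Rightarrow> nat \<Rightarrow> real \<Rightarrow> 'a \<Rightarrow> real" where
  "mixed_modulus T r s f =
     (\<Sum>js\<in>words r. SUP ts\<in>{ts. length ts = r \<and> set ts \<subseteq> {0..s}}. norm (diff_word T (zip js ts) f))"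

definition K_functional :: "(real \<times> real \<Rightarrow> 'a::real_normed_vector \<Rightarrow> 'a) \<Rightarrow> nat \<Rightarrow> real \<Rightarrow> 'a \<Rightarrow> real" where
  "K_functional T r t f =
     Inf {norm f0 + t * Er_norm T r f1 | f0 f1. f1 \<in> Er T r \<and> f = f0 + f1}"

end

theory Submission
  imports Defs
begin

text \<open>
  For $s \ge 1$ both inequalities are trivial, because then $K(s^r,f)$ equals $\|f\|$.
  For $s < 1$ we measure $f$ by the differences $(T(h_1)-I)\cdots(T(h_n)-I)f$ with arbitrary group
  elements $h_i$ at distance $O(s)$ from the identity. Unlike the differences along the two subgroups,
  these are stable under $f \mapsto T(g)f$, since $(T(h)-I)T(g) = T(g)(T(g^{-1}hg)-I)$; and as every
  such $h$ is a product of boundedly many elements of the two subgroups, they are still controlled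
  by $\Omega^r(s,f)$.

  The smooth part is built from $P = s^{-2}\int_0^s\int_0^s T_1(t)T_2(u)\,du\,dt$. Expanding
  $(P + (I-P))^{2r}$ gives $f = P^r y + (I-P)^r z$, where $y$ and $z$ are controlled by the same
  differences as $f$. Moving generators to the right through $P$ changes only the weight of the
  average, so $\mathbb A_{j_1}\cdots\mathbb A_{j_r}P^r$ is a sum of products of $r$ operators
  $\mathbb A_jP'$, each of which is $s^{-1}$ times an average of first differences. Derivatives of
  intermediate order are absorbed by Landau's inequality.
\<close>

text \<open>The obstacle is noncommutativity: moving T(g) past a difference conjugates its group
  element, so bounds must hold on a neighbourhood that is allowed to grow, and each such move may
  cost only a constant. The estimates carry two integers, the number n of differences still
  available and the exponent p of growth in the size of the neighbourhood. Differences are spent one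
  at a time, either on a generator hitting an average (price 1/s) or on a factor I-P (no price in
  s); p stays equal to r throughout the upper estimate. Taking P^r f as smooth part would fail: f -
  P^r f contains in general only one factor I-P, hence is not controlled by r-th differences. This
  forces the splitting with y and z in place of f. The term min(s^r,1)||f|| is unavoidable: the norm
  of E^r contains ||f_1|| itself, while differences do not see invariant vectors. For the trivial
  representation the modulus vanishes and K(s^r,f) = min(s^r,1)||f||.\<close>

declare One_nat_def [simp del]

section \<open>Vector-valued calculus and an interpolation inequality for sequences\<close>

lemma add_eq_imp: "a + b = c \<Longrightarrow> b = c - (a :: 'b :: ab_group_add)"
  by auto

lemma bl_integral:
  assumes "bounded_linear L" "continuous_on {a..b::real} \<phi>"
  shows "L (integral {a..b} \<phi>) = integral {a..b} (\<lambda>u. L (\<phi> u :: 'a::banach))"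
  using integral_linear[OF integrable_continuous_real[OF assms(2)] assms(1)] by (simp add: o_def)

lemma has_vector_derivative_Lim:
  "(f has_vector_derivative y) (at x within X) \<longleftrightarrow>
    ((\<lambda>z. (f z - f x) /\<^sub>R (z - x)) \<longlongrightarrow> y) (at x within X)"
proof -
  have *: "norm (f z - f x - (z - x) *\<^sub>R y) / norm (z - x) = norm ((f z - f x) /\<^sub>R (z - x) - y)" if "z \<noteq> x" for z
  proof -
    have "f z - f x - (z - x) *\<^sub>R y = (z - x) *\<^sub>R ((f z - f x) /\<^sub>R (z - x) - y)"
      using that by (simp add: scaleR_diff_right)
    then show ?thesis using that by (simp only: norm_scaleR) simp
  qed
  have "(f has_vector_derivative y) (at x within X) \<longleftrightarrow>
      ((\<lambda>z. norm ((f z - f x) /\<^sub>R (z - x) - y)) \<longlongrightarrow> 0) (at x within X)"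
    unfolding has_vector_derivative_def has_derivative_iff_norm
    by (simp add: bounded_linear_scaleR_left) (intro tendsto_cong, simp add: eventually_at_filter *[simplified])
  then show ?thesis by (simp add: tendsto_norm_zero_iff LIM_zero_iff)
qed

text \<open>The free parameter t makes this work: a small t bounds each term by a small multiple of
  its successor plus a large multiple of its predecessor. The 4 is Landau's 2, once for each of the
  two letters. \<open>C\<close> precedes the sequence, so it will not depend on the vector
  considered.\<close>

lemma sequence_interpolation:
  "\<exists>C>0. \<forall>a :: nat \<Rightarrow> real. (\<forall>k. 0 \<le> a k) \<longrightarrow>
     (\<forall>k t. Suc (Suc k) \<le> r \<longrightarrow> 0 < t \<longrightarrow> a (Suc k) \<le> 4 / t * a k + t * a (Suc (Suc k))) \<longrightarrow>
     (\<forall>k\<le>r. a k \<le> C * (a 0 + a r))"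
proof -
  define adm where "adm a \<longleftrightarrow> (\<forall>k. 0 \<le> a k) \<and>
     (\<forall>k t. Suc (Suc k) \<le> r \<longrightarrow> 0 < t \<longrightarrow> a (Suc k) \<le> 4 / t * a k + t * a (Suc (Suc k)))" for a :: "nat \<Rightarrow> real"
  have up: "\<forall>\<epsilon>>0. \<exists>C>0. \<forall>a. adm a \<longrightarrow> a k \<le> \<epsilon> * a (Suc k) + C * a 0" if "k < r" for k
    using that
  proof (induction k)
    case 0
    show ?case by (intro allI impI exI[of _ 1]) (auto simp: adm_def)
  next
    case (Suc k)
    show ?case
    proof (intro allI impI)
      fix \<epsilon> :: real assume \<epsilon>: "\<epsilon> > 0"
      define t where "t = \<epsilon> / 2"
      have t: "t > 0" using \<epsilon> by (simp add: t_def)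
      \<comment> \<open>With the coefficient \<open>t / 8\<close> the term
        \<open>4 / t * a k\<close> returns only half of \<open>a (Suc k)\<close>, which the left
        side absorbs.\<close>
      obtain C where C: "C > 0" "\<And>a. adm a \<Longrightarrow> a k \<le> (t / 8) * a (Suc k) + C * a 0"
        using Suc.IH Suc.prems t by (metis Suc_lessD divide_pos_pos zero_less_numeral)
      have "a (Suc k) \<le> \<epsilon> * a (Suc (Suc k)) + (8 / t * C) * a 0" if a: "adm a" for a
      proof -
        have "a (Suc k) \<le> 4 / t * a k + t * a (Suc (Suc k))"
          using a t Suc.prems by (simp add: adm_def)
        also have "\<dots> \<le> 4 / t * ((t / 8) * a (Suc k) + C * a 0) + t * a (Suc (Suc k))"
          using C(2)[OF a] t by (intro add_mono mult_left_mono) auto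
        also have "\<dots> = a (Suc k) / 2 + 4 / t * C * a 0 + t * a (Suc (Suc k))"
          using t by (simp add: field_simps)
        finally have "a (Suc k) \<le> a (Suc k) / 2 + 4 / t * C * a 0 + t * a (Suc (Suc k))" .
        moreover have "8 / t * C * a 0 = 2 * (4 / t * C * a 0)" by simp
        moreover have "\<epsilon> * a (Suc (Suc k)) = 2 * (t * a (Suc (Suc k)))" by (simp add: t_def)
        ultimately have "a (Suc k) \<le> \<epsilon> * a (Suc (Suc k)) + (8 / t * C) * a 0" by linarith
        then show ?thesis by simp
      qed
      then show "\<exists>C>0. \<forall>a. adm a \<longrightarrow> a (Suc k) \<le> \<epsilon> * a (Suc (Suc k)) + C * a 0"
        using t C(1) by (intro exI[of _ "8 / t * C"]) auto
    qed
  qed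
  have down: "\<exists>C>0. \<forall>a. adm a \<longrightarrow> a k \<le> C * (a 0 + a r)" if "k \<le> r" for k
    using that
  proof (induction rule: inc_induct)
    case base
    show ?case by (intro exI[of _ 1]) (auto simp: adm_def)
  next
    case (step k)
    obtain C where C: "C > 0" "\<And>a. adm a \<Longrightarrow> a (Suc k) \<le> C * (a 0 + a r)" using step by blast
    obtain C' where C': "C' > 0" "\<And>a. adm a \<Longrightarrow> a k \<le> 1 * a (Suc k) + C' * a 0"
      using up[of k] step by (metis zero_less_one)
    have "a k \<le> (C + C') * (a 0 + a r)" if a: "adm a" for a
    proof -
      have "0 \<le> a r" using a by (simp add: adm_def)
      then have "C' * a 0 \<le> C' * (a 0 + a r)" using C'(1) by (intro mult_left_mono) auto
      then show ?thesis using C(2)[OF a] C'(2)[OF a] by (simp add: algebra_simps)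
    qed
    then show ?case using C C' by (intro exI[of _ "C + C'"]) auto
  qed
  then obtain C where C: "\<And>k. k \<le> r \<Longrightarrow> C k > 0" "\<And>k a. k \<le> r \<Longrightarrow> adm a \<Longrightarrow> a k \<le> C k * (a 0 + a r)"
    by metis
  have pos: "(\<Sum>k\<le>r. C k) > 0" using C(1) by (intro sum_pos) auto
  have "a k \<le> (\<Sum>k\<le>r. C k) * (a 0 + a r)" if a: "adm a" and k: "k \<le> r" for a k
  proof -
    have "C k \<le> (\<Sum>k\<le>r. C k)" using k C(1) by (intro member_le_sum) (auto intro: less_imp_le)
    moreover have "0 \<le> a 0 + a r" using a by (simp add: adm_def)
    ultimately show ?thesis using C(2)[OF k a] by (meson mult_right_mono order_trans)
  qed
  then show ?thesis using pos unfolding adm_def by (intro exI[of _ "\<Sum>k\<le>r. C k"]) blast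
qed

section \<open>The representation and its two one-parameter subgroups\<close>

locale axb_rep =
  fixes T :: "real \<times> real \<Rightarrow> 'a::banach \<Rightarrow> 'a"
  assumes rep: "contr_rep T"
begin

lemma in_group [simp]: "g \<in> axb_group \<longleftrightarrow> fst g > 0"
  by (simp add: axb_group_def)

lemma T_bl: "fst g > 0 \<Longrightarrow> bounded_linear (T g)"
  using rep unfolding contr_rep_def by simp

lemma T_one [simp]: "T (1, 0) x = x"
  using rep by (simp add: contr_rep_def)

lemma T_T:
  "fst g > 0 \<Longrightarrow> fst h > 0 \<Longrightarrow> T g (T h x) = T (axb_mult g h) x"
  using rep unfolding contr_rep_def by (metis comp_apply in_group)

lemma T_norm: "fst g > 0 \<Longrightarrow> norm (T g x) \<le> norm x"
  using rep unfolding contr_rep_def by simp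

text \<open>Strong continuity becomes joint continuity because the operators are contractions:
  T(g)(x - x0) is small uniformly in g.\<close>

lemma tendsto_T:
  assumes g: "(g \<longlongrightarrow> g0) F" and x: "(x \<longlongrightarrow> x0) F" and pos: "fst g0 > 0"
  shows "((\<lambda>a. T (g a) (x a)) \<longlongrightarrow> T g0 x0) F"
proof -
  have op: "open axb_group"
    unfolding axb_group_def by (intro open_Collect_less continuous_intros)
  have g0: "g0 \<in> axb_group" using pos by (simp add: axb_group_def)
  have "continuous_on axb_group (\<lambda>g. T g x0)" using rep by (auto simp: contr_rep_def)
  then have "isCont (\<lambda>g. T g x0) g0"
    using op g0 by (simp add: continuous_on_eq_continuous_at)
  then have 1: "((\<lambda>a. T (g a) x0) \<longlongrightarrow> T g0 x0) F"
    using g isCont_tendsto_compose by blast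
  have ev: "eventually (\<lambda>a. g a \<in> axb_group) F"
    using g op g0 by (auto simp: tendsto_def)
  have "((\<lambda>a. T (g a) (x a - x0)) \<longlongrightarrow> 0) F"
  proof (rule Lim_null_comparison)
    show "\<forall>\<^sub>F a in F. norm (T (g a) (x a - x0)) \<le> norm (x a - x0)"
      using ev by eventually_elim (auto simp: axb_group_def intro: T_norm)
    show "((\<lambda>a. norm (x a - x0)) \<longlongrightarrow> 0) F"
      using x by (simp add: LIM_zero_iff tendsto_norm_zero)
  qed
  then have "((\<lambda>a. T (g a) (x a - x0) + T (g a) x0) \<longlongrightarrow> 0 + T g0 x0) F"
    using 1 by (rule tendsto_add)
  moreover have "eventually (\<lambda>a. T (g a) (x a - x0) + T (g a) x0 = T (g a) (x a)) F"
    using ev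
    by eventually_elim (auto simp: axb_group_def bounded_linear.linear linear_diff T_bl)
  ultimately show ?thesis by (simp add: filterlim_cong)
qed

definition subgrp_elem :: "nat \<Rightarrow> real \<Rightarrow> real \<times> real" where
  "subgrp_elem j t = (if j = 1 then (exp t, 0) else (1, t))"

abbreviation S where "S \<equiv> opgrp T"

lemma S_subgrp_elem: "S j t = T (subgrp_elem j t)"
  by (simp add: opgrp_def subgrp_elem_def)

lemma subgrp_elem_pos [simp]: "fst (subgrp_elem j t) > 0" by (simp add: subgrp_elem_def)

lemma S_bl: "bounded_linear (S j t)" by (simp add: S_subgrp_elem T_bl)

lemma S_lin: "linear (S j t)" using S_bl bounded_linear.linear by blast

lemmas S_diff = linear_diff[OF S_lin] and S_add = linear_add[OF S_lin]
  and S_scale = linear_cmul[OF S_lin] and S_zero = linear_0[OF S_lin]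

lemma S_norm: "norm (S j t x) \<le> norm x" by (simp add: S_subgrp_elem T_norm)

lemma S_0 [simp]: "S j 0 x = x" by (simp add: opgrp_def)

lemma S_S: "S j t (S j u x) = S j (t + u) x"
  unfolding S_subgrp_elem by (subst T_T) (auto simp: subgrp_elem_def axb_mult_def exp_add algebra_simps)

lemma tendsto_S:
  assumes "(t \<longlongrightarrow> t0) F" "(x \<longlongrightarrow> x0) F"
  shows "((\<lambda>a. S j (t a) (x a)) \<longlongrightarrow> S j t0 x0) F"
  unfolding S_subgrp_elem
  by (rule tendsto_T) (auto simp: subgrp_elem_def intro!: tendsto_intros assms)

lemma continuous_on_S [continuous_intros]:
  assumes "continuous_on A t" "continuous_on A x"
  shows "continuous_on A (\<lambda>a. S j (t a) (x a))"
  using assms unfolding continuous_on_def by (auto intro!: tendsto_S)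

text \<open>Both sides are T(e^t, e^t u)x: a dilation rescales the translation that it
  passes.\<close>

lemma S12: "S 1 t (S 2 u x) = S 2 (exp t * u) (S 1 t x)"
  unfolding S_subgrp_elem by (simp add: T_T) (simp add: subgrp_elem_def axb_mult_def)

lemma S21: "S 2 u (S 1 t x) = S 1 t (S 2 (exp (- t) * u) x)"
proof -
  have "exp t * (exp (- t) * u) = u" by (simp add: exp_minus)
  then show ?thesis by (simp only: S12)
qed

subsection \<open>Generators of the one-parameter subgroups\<close>

lemma gen_unique: "has_gen (S j) F y \<Longrightarrow> has_gen (S j) F z \<Longrightarrow> y = z"
  unfolding has_gen_def using tendsto_unique trivial_limit_at_right_real by blast

lemma gen_add:
  "has_gen (S j) F y \<Longrightarrow> has_gen (S j) H z \<Longrightarrow> has_gen (S j) (F + H) (y + z)"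
  unfolding has_gen_def by (drule (1) tendsto_add) (simp add: S_add algebra_simps)

lemma gen_scale: "has_gen (S j) F y \<Longrightarrow> has_gen (S j) (c *\<^sub>R F) (c *\<^sub>R y)"
  unfolding has_gen_def
  by (drule tendsto_scaleR[OF tendsto_const[of c]]) (simp add: S_scale algebra_simps)

lemma gen_0: "has_gen (S j) 0 0"
  unfolding has_gen_def by (simp add: S_zero)

lemma gen_deriv:
  assumes "has_gen (S j) F y"
  shows "((\<lambda>t. S j t F) has_vector_derivative S j t y) (at t)"
proof -
  have lim: "((\<lambda>h. (S j h F - F) /\<^sub>R h) \<longlongrightarrow> y) (at_right 0)"
    using assms by (simp add: has_gen_def)
  have "((\<lambda>h. (S j (t + h) F - S j t F) /\<^sub>R h) \<longlongrightarrow> S j t y) (at 0)"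
    unfolding filterlim_at_split
  proof
    have "((\<lambda>h. S j t ((S j h F - F) /\<^sub>R h)) \<longlongrightarrow> S j t y) (at_right 0)"
      by (intro tendsto_S lim tendsto_const)
    then show "((\<lambda>h. (S j (t + h) F - S j t F) /\<^sub>R h) \<longlongrightarrow> S j t y) (at_right 0)"
      by (simp add: S_S S_diff S_scale)
    \<comment> \<open>For the left derivative the quotient is moved by T_j(t - h), which varies with
      h; here joint continuity enters.\<close>
    have "((\<lambda>h. S j (t - h) ((S j h F - F) /\<^sub>R h)) \<longlongrightarrow> S j (t - 0) y) (at_right 0)"
      by (intro tendsto_S lim tendsto_intros)
    then show "((\<lambda>h. (S j (t + h) F - S j t F) /\<^sub>R h) \<longlongrightarrow> S j t y) (at_left 0)"
      unfolding filterlim_at_left_to_right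
      by (simp add: S_S S_diff S_scale scaleR_diff_right)
  qed
  then show ?thesis
    unfolding has_vector_derivative_Lim using LIM_offset_zero_iff[of t "\<lambda>z. (S j z F - S j t F) /\<^sub>R (z - t)"] by simp
qed

lemma gen_integral:
  assumes "has_gen (S j) F y" "t \<ge> 0"
  shows "S j t F - F = integral {0..t} (\<lambda>u. S j u y)"
  using fundamental_theorem_of_calculus[OF assms(2), of "\<lambda>u. S j u F" "\<lambda>u. S j u y"]
    gen_deriv[OF assms(1)] has_vector_derivative_at_within
  by (metis S_0 integral_unique)

text \<open>The converse of \<open>gen_integral\<close>, by differentiating the primitive at 0. The
  integrated identity is a convenient criterion for the domain, since it can itself be integrated
  over a parameter.\<close>

lemma gen_from_integral:
  assumes "\<And>t. t \<in> {0..1} \<Longrightarrow> S j t F - F = integral {0..t} (\<lambda>u. S j u y)"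
  shows "has_gen (S j) F y"
proof -
  have "((\<lambda>u. integral {0..u} (\<lambda>u. S j u y)) has_vector_derivative S j 0 y) (at 0 within {0..1})"
    by (rule integral_has_vector_derivative) (auto intro!: continuous_intros)
  then have "((\<lambda>u. integral {0..u} (\<lambda>u. S j u y) /\<^sub>R u) \<longlongrightarrow> y) (at 0 within {0..1})"
    by (simp add: has_vector_derivative_Lim)
  then have "((\<lambda>u. (S j u F - F) /\<^sub>R u) \<longlongrightarrow> y) (at 0 within {0..1})"
    by (rule Lim_transform_eventually) (simp add: eventually_at_filter assms)
  moreover have "at 0 within {0..1} = at_right (0::real)"
    by (rule at_within_Icc_at_right) simp
  ultimately show ?thesis by (simp add: has_gen_def)
qed

text \<open>Closedness of the generator, for integrals in place of limits: the identity of
  \<open>gen_integral\<close> is integrated over the parameter and the two integrations are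
  exchanged.\<close>

lemma gen_closed:
  assumes gen: "\<And>u. u \<in> {a..b::real} \<Longrightarrow> has_gen (S j) (\<phi> u) (\<psi> u)"
    and c: "continuous_on {a..b} \<phi>" "continuous_on {a..b} \<psi>"
  shows "has_gen (S j) (integral {a..b} \<phi>) (integral {a..b} \<psi>)"
proof (rule gen_from_integral)
  fix t :: real assume t: "t \<in> {0..1}"
  have "S j t (integral {a..b} \<phi>) - integral {a..b} \<phi> = integral {a..b} (\<lambda>u. S j t (\<phi> u) - \<phi> u)"
    by (subst bl_integral[OF S_bl c(1)])
      (intro integral_diff[symmetric] integrable_continuous_real continuous_intros c)
  also have "\<dots> = integral {a..b} (\<lambda>u. integral {0..t} (\<lambda>v. S j v (\<psi> u)))"
    using t by (intro integral_cong gen_integral gen) auto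
  also have "\<dots> = integral {0..t} (\<lambda>v. integral {a..b} (\<lambda>u. S j v (\<psi> u)))"
  proof -
    have "continuous_on ({a..b} \<times> {0..t}) (\<lambda>x. S j (snd x) (\<psi> (fst x)))"
      by (intro continuous_intros continuous_on_compose2[OF c(2)]) auto
    then show ?thesis
      using integral_swap_continuous[of a 0 b t "\<lambda>u v. S j v (\<psi> u)"]
      by (simp add: split_def cbox_Pair_eq)
  qed
  also have "\<dots> = integral {0..t} (\<lambda>v. S j v (integral {a..b} \<psi>))"
    by (simp add: bl_integral[OF S_bl c(2)])
  finally show "S j t (integral {a..b} \<phi>) - integral {a..b} \<phi>
     = integral {0..t} (\<lambda>v. S j v (integral {a..b} \<psi>))" .
qed

text \<open>Shifting [0,t] by h and shifting [0,h] by t lead to the same difference of integrals,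
  once all are expressed by primitives starting at 0.\<close>

lemma gen_primitive:
  assumes "t \<ge> 0"
  shows "has_gen (S j) (integral {0..t} (\<lambda>u. S j u F)) (S j t F - F)"
proof (rule gen_from_integral)
  fix h :: real assume h: "h \<in> {0..1}"
  have int: "(\<lambda>u. S j u F) integrable_on {c..d}" for c d
    by (intro integrable_continuous_real continuous_intros)
  have sh: "integral {0..c} (\<lambda>u. S j d (S j u F)) = integral {d..c+d} (\<lambda>u. S j u F)" for c d
    using integral_shift_Icc_real[of 0 c "\<lambda>u. S j u F" d] by (simp add: o_def S_S)
  have "S j h (integral {0..t} (\<lambda>u. S j u F)) = integral {0..t} (\<lambda>u. S j h (S j u F))"
    by (rule bl_integral[OF S_bl]) (intro continuous_intros)
  then have 1: "S j h (integral {0..t} (\<lambda>u. S j u F)) = integral {h..t+h} (\<lambda>u. S j u F)"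
    by (simp only: sh)
  have "integral {0..h} (\<lambda>u. S j u (S j t F - F)) =
    integral {0..h} (\<lambda>u. S j t (S j u F) - S j u F)"
    by (simp only: S_S S_diff add.commute)
  also have "\<dots> = integral {0..h} (\<lambda>u. S j t (S j u F)) - integral {0..h} (\<lambda>u. S j u F)"
    by (intro integral_diff integrable_continuous_real continuous_intros)
  finally have 2: "integral {0..h} (\<lambda>u. S j u (S j t F - F)) =
     integral {t..h+t} (\<lambda>u. S j u F) - integral {0..h} (\<lambda>u. S j u F)"
    by (simp only: sh)
  have "integral {0..h} (\<lambda>u. S j u F) + integral {h..t+h} (\<lambda>u. S j u F) =
     integral {0..t+h} (\<lambda>u. S j u F)"
    using assms h by (intro Henstock_Kurzweil_Integration.integral_combine int) auto
  then have 3: "integral {h..t+h} (\<lambda>u. S j u F) =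
     integral {0..t+h} (\<lambda>u. S j u F) - integral {0..h} (\<lambda>u. S j u F)"
    by (rule add_eq_imp)
  have "integral {0..t} (\<lambda>u. S j u F) + integral {t..t+h} (\<lambda>u. S j u F) =
     integral {0..t+h} (\<lambda>u. S j u F)"
    using assms h by (intro Henstock_Kurzweil_Integration.integral_combine int) auto
  then have 4: "integral {t..t+h} (\<lambda>u. S j u F) =
     integral {0..t+h} (\<lambda>u. S j u F) - integral {0..t} (\<lambda>u. S j u F)"
    by (rule add_eq_imp)
  show "S j h (integral {0..t} (\<lambda>u. S j u F)) - integral {0..t} (\<lambda>u. S j u F) =
         integral {0..h} (\<lambda>u. S j u (S j t F - F))"
    unfolding 1 2 3 add.commute[of h t] 4 by (simp add: algebra_simps)
qed

text \<open>
  Integration by parts, applied to the primitive of $u \mapsto T_j(u)F$, puts the generator into the form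
  of an average of differences for every $F$, not only for those in its domain.
\<close>

lemma gen_weighted:
  assumes s: "s \<ge> 0" and \<alpha>: "\<And>u. u \<in> {0..s} \<Longrightarrow> (\<alpha> has_real_derivative \<alpha>' u) (at u within {0..s})"
    and c: "continuous_on {0..s} \<alpha>'"
  shows "has_gen (S j) (integral {0..s} (\<lambda>u. \<alpha> u *\<^sub>R S j u F))
    (\<alpha> s *\<^sub>R (S j s F - F) - integral {0..s} (\<lambda>u. \<alpha>' u *\<^sub>R (S j u F - F)))"
proof -
  define V where "V u = integral {0..u} (\<lambda>u. S j u F)" for u
  have V: "(V has_vector_derivative S j u F) (at u within {0..s})" if "u \<in> {0..s}" for u
    unfolding V_def using that by (intro integral_has_vector_derivative continuous_intros)
  have cV: "continuous_on {0..s} V"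
    by (rule continuous_on_vector_derivative) (rule V)
  have c\<alpha>: "continuous_on {0..s} \<alpha>"
    by (rule DERIV_continuous_on) (rule \<alpha>)
  have "((\<lambda>u. \<alpha> u *\<^sub>R S j u F + \<alpha>' u *\<^sub>R V u) has_integral (\<alpha> s *\<^sub>R V s - \<alpha> 0 *\<^sub>R V 0)) {0..s}"
    using s by (intro fundamental_theorem_of_calculus has_vector_derivative_scaleR \<alpha> V)
  moreover have "V 0 = 0" by (simp add: V_def)
  ultimately have "integral {0..s} (\<lambda>u. \<alpha> u *\<^sub>R S j u F + \<alpha>' u *\<^sub>R V u) = \<alpha> s *\<^sub>R V s"
    by (simp add: integral_unique)
  moreover have "integral {0..s} (\<lambda>u. \<alpha> u *\<^sub>R S j u F + \<alpha>' u *\<^sub>R V u) =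
     integral {0..s} (\<lambda>u. \<alpha> u *\<^sub>R S j u F) + integral {0..s} (\<lambda>u. \<alpha>' u *\<^sub>R V u)"
    by (intro integral_add integrable_continuous_real continuous_intros c c\<alpha> cV)
  ultimately have eq: "integral {0..s} (\<lambda>u. \<alpha> u *\<^sub>R S j u F) =
     \<alpha> s *\<^sub>R V s + (-1) *\<^sub>R integral {0..s} (\<lambda>u. \<alpha>' u *\<^sub>R V u)" by (simp add: algebra_simps)
  have "has_gen (S j) (V u) (S j u F - F)" if "u \<in> {0..s}" for u
    unfolding V_def using that by (intro gen_primitive) auto
  then have "has_gen (S j) (\<alpha> s *\<^sub>R V s + (-1) *\<^sub>R integral {0..s} (\<lambda>u. \<alpha>' u *\<^sub>R V u))
     (\<alpha> s *\<^sub>R (S j s F - F) + (-1) *\<^sub>R integral {0..s} (\<lambda>u. \<alpha>' u *\<^sub>R (S j u F - F)))"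
    using s by (intro gen_add gen_scale gen_closed continuous_intros c cV) auto
  then show ?thesis unfolding eq by simp
qed

text \<open>By \<open>S12\<close> the quotient splits into S_2(e^t u) applied to the quotient of F
  along T_1, and the change of S_2 from u to e^t u. The latter is a quotient along T_2 with
  increment e(t) = (e^t - 1)u, and e(t)/t tends to u. For u > 0 the increment is positive, as the
  right limit in \<open>has_gen\<close> demands; for u = 0 it degenerates.\<close>

lemma gen1_S2:
  assumes 1: "has_gen (S 1) F F1" and 2: "has_gen (S 2) F F2" and u: "u \<ge> 0"
  shows "has_gen (S 1) (S 2 u F) (S 2 u F1 + u *\<^sub>R S 2 u F2)"
proof (cases "u = 0")
  case True then show ?thesis using 1 by simp
next
  case False
  define e where "e t = (exp t - 1) * u" for t :: real
  have e0: "((\<lambda>t. e t / t) \<longlongrightarrow> u) (at_right 0)"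
  proof -
    have "(e has_real_derivative u) (at 0)" unfolding e_def by (auto intro!: derivative_eq_intros)
    then have "((\<lambda>t. e t / t) \<longlongrightarrow> u) (at 0)" by (simp add: has_field_derivative_iff e_def)
    then show ?thesis by (rule filterlim_mono) (auto simp: at_within_le_at)
  qed
  have e: "filterlim e (at_right 0) (at_right 0)"
    unfolding e_def filterlim_at
    using False u by (auto simp: eventually_at_filter intro!: tendsto_eq_intros always_eventually)
  have "((\<lambda>t. (S 2 (e t) F - F) /\<^sub>R e t) \<longlongrightarrow> F2) (at_right 0)"
    using filterlim_compose[OF 2[unfolded has_gen_def] e] .
  then have "((\<lambda>t. S 2 (exp t * u) ((S 1 t F - F) /\<^sub>R t) +
       S 2 u ((e t / t) *\<^sub>R ((S 2 (e t) F - F) /\<^sub>R e t))) \<longlongrightarrow> S 2 (exp 0 * u) F1 + S 2 u (u *\<^sub>R F2)) (at_right 0)"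
    using 1[unfolded has_gen_def] e0 by (intro tendsto_intros tendsto_S)
  moreover have "eventually (\<lambda>t. S 2 (exp t * u) ((S 1 t F - F) /\<^sub>R t) +
       S 2 u ((e t / t) *\<^sub>R ((S 2 (e t) F - F) /\<^sub>R e t)) = (S 1 t (S 2 u F) - S 2 u F) /\<^sub>R t) (at_right 0)"
    unfolding eventually_at_filter
  proof (rule always_eventually, intro allI impI)
    fix t :: real assume "t \<noteq> 0" "t \<in> {0<..}"
    then have "e t \<noteq> 0" using False by (auto simp: e_def)
    then have "(e t / t) *\<^sub>R ((S 2 (e t) F - F) /\<^sub>R e t) = (S 2 (e t) F - F) /\<^sub>R t"
      by (simp add: divide_inverse mult.commute)
    moreover have eq: "u + e t = exp t * u" by (simp add: e_def algebra_simps)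
    ultimately have "S 2 u ((e t / t) *\<^sub>R ((S 2 (e t) F - F) /\<^sub>R e t)) = (S 2 (exp t * u) F - S 2 u F) /\<^sub>R t"
      by (simp only: S_scale S_diff S_S)
    moreover have "S 2 (exp t * u) ((S 1 t F - F) /\<^sub>R t) = (S 1 t (S 2 u F) - S 2 (exp t * u) F) /\<^sub>R t"
      by (simp only: S_scale S_diff S12)
    ultimately show "S 2 (exp t * u) ((S 1 t F - F) /\<^sub>R t) +
       S 2 u ((e t / t) *\<^sub>R ((S 2 (e t) F - F) /\<^sub>R e t)) = (S 1 t (S 2 u F) - S 2 u F) /\<^sub>R t"
      by (simp only: scaleR_right_distrib[symmetric]) simp
  qed
  ultimately have "((\<lambda>t. (S 1 t (S 2 u F) - S 2 u F) /\<^sub>R t) \<longlongrightarrow> S 2 (exp 0 * u) F1 + S 2 u (u *\<^sub>R F2)) (at_right 0)"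
    by (rule Lim_transform_eventually)
  then show ?thesis by (simp add: has_gen_def S_scale)
qed

text \<open>By \<open>S21\<close> a step h taken after S_1(t) is a step e^(-t) h taken before it;
  the factor is the ratio of the steps.\<close>

lemma gen2_S1:
  assumes 2: "has_gen (S 2) F F2"
  shows "has_gen (S 2) (S 1 t F) (exp (- t) *\<^sub>R S 1 t F2)"
proof -
  let ?c = "exp (- t)"
  have "filterlim (\<lambda>h. ?c * h) (at_right 0) (at_right 0)"
    unfolding filterlim_at
    by (auto simp: eventually_at_filter intro!: tendsto_eq_intros always_eventually)
  from filterlim_compose[OF 2[unfolded has_gen_def] this]
  have "((\<lambda>h. S 1 t (?c *\<^sub>R ((S 2 (?c * h) F - F) /\<^sub>R (?c * h)))) \<longlongrightarrow> S 1 t (?c *\<^sub>R F2)) (at_right 0)"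
    by (intro tendsto_S tendsto_intros)
  moreover have "S 1 t (?c *\<^sub>R ((S 2 (?c * h) F - F) /\<^sub>R (?c * h))) = (S 2 h (S 1 t F) - S 1 t F) /\<^sub>R h" for h
    by (simp add: S21 S_scale S_diff divide_inverse)
  ultimately show ?thesis by (simp add: has_gen_def S_scale)
qed

subsection \<open>Differences along group elements near the identity\<close>

text \<open>The dilation part (on a logarithmic scale) and the translation part are bounded
  separately because conjugation fixes the first and can enlarge only the second.\<close>

definition box :: "real \<Rightarrow> real \<Rightarrow> (real \<times> real) set" where
  "box \<tau> \<beta> = {(exp t, b) | t b. \<bar>t\<bar> \<le> \<tau> \<and> \<bar>b\<bar> \<le> \<beta>}"

text \<open>This is g^(-1) h g, written out.\<close>

definition grp_conj :: "real \<times> real \<Rightarrow> real \<times> real \<Rightarrow> real \<times> real" where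
  "grp_conj g h = (fst h, (fst h * snd g + snd h - snd g) / fst g)"

fun iter_diff :: "(real \<times> real) list \<Rightarrow> 'a \<Rightarrow> 'a" where
  "iter_diff [] x = x"
| "iter_diff (h # hs) x = T h (iter_diff hs x) - iter_diff hs x"

text \<open>
  A polynomially growing bound in $K$ survives conjugation by group elements, which only multiplies $K$
  by a constant; so no radius has to be tracked.
\<close>

definition diff_bound :: "real \<Rightarrow> nat \<Rightarrow> nat \<Rightarrow> 'a \<Rightarrow> real \<Rightarrow> bool" where
  "diff_bound s p n x M \<longleftrightarrow> (\<forall>K\<ge>1. \<forall>hs. length hs = n \<longrightarrow> set hs \<subseteq> box s (K * s) \<longrightarrow> norm (iter_diff hs x) \<le> M * K ^ p)"

lemma diff_boundD:
  "diff_bound s p n x M \<Longrightarrow> K \<ge> 1 \<Longrightarrow> length hs = n \<Longrightarrow>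
    set hs \<subseteq> box s (K * s) \<Longrightarrow> norm (iter_diff hs x) \<le> M * K ^ p"
  by (simp add: diff_bound_def)

lemma box_pos: "h \<in> box \<tau> \<beta> \<Longrightarrow> fst h > 0"
  by (auto simp: box_def)

lemma box_mono:
  "\<tau> \<le> \<tau>' \<Longrightarrow> \<beta> \<le> \<beta>' \<Longrightarrow>
    box \<tau> \<beta> \<subseteq> box \<tau>' \<beta>'"
  unfolding box_def by force

lemma subgrp_elem_box: "\<bar>t\<bar> \<le> s \<Longrightarrow> subgrp_elem j t \<in> box s s"
  by (auto simp: subgrp_elem_def box_def intro!: exI[of _ "0::real"])

lemma abs_exp_minus_one:
  fixes t s :: real
  assumes "\<bar>t\<bar> \<le> s" "s \<le> 1"
  shows "\<bar>exp t - 1\<bar> \<le> 2 * s"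
proof (cases "t \<ge> 0")
  case True
  have "exp t \<le> 1 + t + t\<^sup>2" using True assms by (intro exp_bound) auto
  moreover have "t\<^sup>2 \<le> t" using True assms by (simp add: power2_eq_square mult_left_le_one_le)
  moreover have "exp t \<ge> 1" using True by simp
  ultimately show ?thesis using assms by linarith
next
  case False
  have "exp t \<ge> 1 + t" by (rule exp_ge_add_one_self)
  moreover have "exp t \<le> 1" using False by simp
  ultimately show ?thesis using assms by linarith
qed

text \<open>The translation part of the conjugate is ((e^t - 1)c + b)/e^v. The possibly large c
  meets the factor e^t - 1 = O(s), so the numerator is at most 3Ks and the quotient at most 9Ks; 12
  is a rounded constant.\<close>

lemma grp_conj_box:
  assumes g: "g \<in> box 1 K" and h: "h \<in> box s (K * s)" and K: "K \<ge> 1" and s: "0 < s" "s \<le> 1"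
  shows "grp_conj g h \<in> box s (12 * K * s)"
proof -
  obtain v c where gv: "g = (exp v, c)" "\<bar>v\<bar> \<le> 1" "\<bar>c\<bar> \<le> K" using g by (auto simp: box_def)
  obtain t b where ht: "h = (exp t, b)" "\<bar>t\<bar> \<le> s" "\<bar>b\<bar> \<le> K * s" using h by (auto simp: box_def)
  have "exp t * c + b - c = (exp t - 1) * c + b" by (simp add: algebra_simps)
  also have "\<bar>\<dots>\<bar> \<le> \<bar>exp t - 1\<bar> * \<bar>c\<bar> + \<bar>b\<bar>"
    by (metis abs_mult abs_triangle_ineq)
  also have "\<dots> \<le> (2 * s) * K + K * s"
    using gv ht s abs_exp_minus_one[OF ht(2) s(2)] by (intro add_mono mult_mono) auto
  finally have 1: "\<bar>exp t * c + b - c\<bar> \<le> 3 * K * s" by (simp add: algebra_simps)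
  have "exp (- v) \<le> exp 1" using gv by simp
  also have "\<dots> \<le> 3" by (rule exp_le)
  finally have "exp (- v) \<le> 3" .
  have "\<bar>(exp t * c + b - c) / exp v\<bar> = \<bar>exp t * c + b - c\<bar> * exp (- v)"
    by (simp add: exp_minus abs_mult divide_inverse)
  also have "\<dots> \<le> (3 * K * s) * 3"
    using 1 \<open>exp (- v) \<le> 3\<close> K s by (intro mult_mono) auto
  also have "\<dots> \<le> 12 * K * s" using K s by simp
  finally show ?thesis using gv ht by (auto simp: box_def grp_conj_def)
qed

lemma grp_conj_pos: "fst h > 0 \<Longrightarrow> fst (grp_conj g h) > 0" by (simp add: grp_conj_def)

lemma T_grp_conj:
  "fst g > 0 \<Longrightarrow> fst h > 0 \<Longrightarrow> T h (T g x) = T g (T (grp_conj g h) x)"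
  by (simp add: T_T grp_conj_pos) (simp add: axb_mult_def grp_conj_def mult.commute)

lemma T_diff: "fst g > 0 \<Longrightarrow> T g (x - y) = T g x - T g y"
  using T_bl bounded_linear.linear linear_diff by blast

lemma iter_diff_bl:
  "\<forall>h\<in>set hs. fst h > 0 \<Longrightarrow> bounded_linear (iter_diff hs)"
proof (induction hs)
  case Nil
  have "iter_diff [] = (\<lambda>x. x)" by (rule ext) simp
  then show ?case by (simp add: bounded_linear_ident)
next
  case (Cons h hs)
  moreover have "iter_diff (h # hs) = (\<lambda>x. T h (iter_diff hs x) - iter_diff hs x)" by (rule ext) simp
  ultimately show ?case
    using bounded_linear_sub[OF bounded_linear_compose[OF T_bl[of h]], of "iter_diff hs" "iter_diff hs"] by simp
qed

lemma iter_diff_append: "iter_diff (hs @ hs') x = iter_diff hs (iter_diff hs' x)"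
  by (induction hs) auto

lemma iter_diff_T:
  "\<forall>h\<in>set hs. fst h > 0 \<Longrightarrow> fst g > 0 \<Longrightarrow>
    iter_diff hs (T g x) = T g (iter_diff (map (grp_conj g) hs) x)"
  by (induction hs) (auto simp: T_diff T_grp_conj)

lemma iter_diff_linear:
  "set hs \<subseteq> box \<tau> \<beta> \<Longrightarrow> linear (iter_diff hs)"
  by (meson iter_diff_bl box_pos bounded_linear.linear subsetD)

text \<open>T(g) is pulled out and discarded as a contraction; the conjugates lie in the box for
  12K, whence 12^p. Here g may itself have size K, as \<open>diff_bound_step\<close> requires for
  translations by up to K.\<close>

lemma diff_bound_T_aux:
  assumes "diff_bound s p n x M" "K \<ge> 1" "g \<in> box 1 K" "length hs = n" "set hs \<subseteq> box s (K * s)"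
    and s: "0 < s" "s \<le> 1"
  shows "norm (iter_diff hs (T g x)) \<le> 12 ^ p * M * K ^ p"
proof -
  have g: "fst g > 0" using assms box_pos by blast
  have "norm (iter_diff hs (T g x)) \<le> norm (iter_diff (map (grp_conj g) hs) x)"
    using assms g by (subst iter_diff_T) (auto intro: T_norm box_pos)
  also have "\<dots> \<le> M * (12 * K) ^ p"
    using assms by (intro diff_boundD[OF assms(1)]) (auto intro!: grp_conj_box)
  finally show ?thesis by (simp add: power_mult_distrib mult_ac)
qed

lemma diff_bound_T:
  assumes "diff_bound s p n x M" "g \<in> box 1 1" "0 < s" "s \<le> 1"
  shows "diff_bound s p n (T g x) (12 ^ p * M)"
  unfolding diff_bound_def
proof (intro allI impI)
  fix K hs assume "1 \<le> (K::real)" "length hs = n" "set hs \<subseteq> box s (K * s)"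
  then show "norm (iter_diff hs (T g x)) \<le> 12 ^ p * M * K ^ p"
    using box_mono[of 1 1 1 K] assms by (intro diff_bound_T_aux) auto
qed

lemma diff_bound_S:
  assumes "diff_bound s p n x M" "\<bar>t\<bar> \<le> 1" "0 < s" "s \<le> 1"
  shows "diff_bound s p n (S j t x) (12 ^ p * M)"
  unfolding S_subgrp_elem using assms by (intro diff_bound_T subgrp_elem_box)

lemma diff_bound_mono:
  "diff_bound s p n x M \<Longrightarrow> M \<le> M' \<Longrightarrow> diff_bound s p n x M'"
  unfolding diff_bound_def
proof (intro allI impI)
  fix K hs assume *: "M \<le> M'" "1 \<le> K" "length hs = n" "set hs \<subseteq> box s (K * s)"
    "\<forall>K\<ge>1. \<forall>hs. length hs = n \<longrightarrow> set hs \<subseteq> box s (K * s) \<longrightarrow> norm (iter_diff hs x) \<le> M * K ^ p"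
  then have "norm (iter_diff hs x) \<le> M * K ^ p" by blast
  also have "\<dots> \<le> M' * K ^ p" using * by (intro mult_right_mono) auto
  finally show "norm (iter_diff hs x) \<le> M' * K ^ p" .
qed

lemma diff_bound_add:
  "diff_bound s p n x M \<Longrightarrow> diff_bound s p n y M' \<Longrightarrow>
    diff_bound s p n (x + y) (M + M')"
  unfolding diff_bound_def
  by (auto simp: linear_add[OF iter_diff_linear] distrib_right intro!: norm_triangle_mono)

lemma diff_bound_scale:
  "diff_bound s p n x M \<Longrightarrow> diff_bound s p n (c *\<^sub>R x) (\<bar>c\<bar> * M)"
  unfolding diff_bound_def
  by (auto simp: linear_cmul[OF iter_diff_linear] mult.assoc intro!: mult_left_mono)

lemma diff_bound_diff:
  "diff_bound s p n x M \<Longrightarrow> diff_bound s p n y M' \<Longrightarrow>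
    diff_bound s p n (x - y) (M + M')"
  using diff_bound_add[of s p n x M "- y" M'] diff_bound_scale[of s p n y M' "-1"] by simp

lemma diff_bound_zero: "diff_bound s p n 0 0"
  unfolding diff_bound_def by (auto simp: linear_0[OF iter_diff_linear])

text \<open>Tested on a list of identity elements with K = 1.\<close>

lemma diff_bound_nonneg:
  "diff_bound s p n x M \<Longrightarrow> 0 \<le> s \<Longrightarrow> 0 \<le> M"
  using diff_boundD[of s p n x M 1 "replicate n (1, 0)"]
  by (force simp: box_def intro: order_trans[OF norm_ge_zero] exI[of _ "0::real"])

text \<open>\<open>h\<close> becomes the innermost difference. The order drops while the exponent
  \<open>p\<close> stays.\<close>

lemma diff_bound_D:
  assumes "diff_bound s p (n + 1) x M" "h \<in> box s s" "0 < s"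
  shows "diff_bound s p n (T h x - x) M"
  unfolding diff_bound_def
proof (intro allI impI)
  fix K hs assume K: "1 \<le> (K::real)" and hs: "length hs = n" "set hs \<subseteq> box s (K * s)"
  have "box s s \<subseteq> box s (K * s)" using K assms by (intro box_mono) auto
  then have "norm (iter_diff (hs @ [h]) x) \<le> M * K ^ p"
    using K hs assms by (intro diff_boundD[OF assms(1)]) auto
  then show "norm (iter_diff hs (T h x - x)) \<le> M * K ^ p" by (simp add: iter_diff_append)
qed

lemma diff_bound_integral:
  assumes "\<And>u. u \<in> {a..b} \<Longrightarrow> diff_bound s p n (\<phi> u) M" "continuous_on {a..b} \<phi>" "a \<le> b"
  shows "diff_bound s p n (integral {a..b} \<phi>) ((b - a) * M)"
  unfolding diff_bound_def
proof (intro allI impI)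
  fix K hs assume K: "1 \<le> (K::real)" and hs: "length hs = n" "set hs \<subseteq> box s (K * s)"
  have bl: "bounded_linear (iter_diff hs)" using hs by (auto intro!: iter_diff_bl box_pos)
  have "norm (iter_diff hs (integral {a..b} \<phi>)) = norm (integral {a..b} (\<lambda>u. iter_diff hs (\<phi> u)))"
    by (simp add: bl_integral[OF bl assms(2)])
  also have "\<dots> \<le> M * K ^ p * (b - a)"
    using K hs assms by (intro integral_bound diff_boundD bounded_linear.continuous_on[OF bl]) auto
  finally show "norm (iter_diff hs (integral {a..b} \<phi>)) \<le> (b - a) * M * K ^ p" by (simp add: mult_ac)
qed

text \<open>
  An element of the box is a product of $O(K)$ subgroup elements with parameters of size at most $s$;
  negative parameters are removed by $T_j(t)-I = -T_j(t)(T_j(-t)-I)$.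
\<close>

lemma diff_bound_step:
  assumes H: "\<And>j t. j \<in> {1, 2} \<Longrightarrow> t \<in> {0..s} \<Longrightarrow> diff_bound s p n (S j t x - x) M"
    and s: "0 < s" "s \<le> 1"
  shows "diff_bound s (p + 1) (n + 1) x (3 * 12 ^ p * M)"
  unfolding diff_bound_def
proof (intro allI impI)
  fix K hs assume K: "1 \<le> (K::real)" and hs: "length hs = n + 1" "set hs \<subseteq> box s (K * s)"
  obtain hs' h where hsh: "hs = hs' @ [h]" using hs by (metis Suc_eq_plus1 length_Suc_conv_rev)
  obtain t b where h: "h = (exp t, b)" "\<bar>t\<bar> \<le> s" "\<bar>b\<bar> \<le> K * s"
    using hs by (auto simp: hsh box_def)
  define B where "B = 12 ^ p * M * K ^ p"
  have hs': "length hs' = n" "set hs' \<subseteq> box s (K * s)" using hs by (auto simp: hsh)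
  have lin: "linear (iter_diff hs')" using hs'(2) by (rule iter_diff_linear)
  have key: "norm (iter_diff hs' (T g (S j t x - x))) \<le> B"
    if "g \<in> box 1 K" "j \<in> {1, 2}" "t \<in> {0..s}" for g j t
    unfolding B_def by (rule diff_bound_T_aux[OF H[OF that(2,3)] K that(1) hs' s])
  have neg: "S j t x - x = - S j t (S j (- t) x - x)" for j t
    by (simp add: S_diff S_S)
  have "K * s \<le> K * 1" using K s by (intro mult_left_mono) auto
  then have bK: "\<bar>b\<bar> \<le> K" using h(3) by simp
  have s0B: "0 \<le> B" using key[of "(1,0)" 1 0] K s by (force simp: box_def S_diff linear_0[OF lin] T_diff)
  have part1: "norm (iter_diff hs' (T (1, b) (S 1 t x - x))) \<le> B"
  proof (cases "t \<ge> 0")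
    case True
    then show ?thesis using h bK by (intro key) (auto simp: box_def intro!: exI[of _ "0::real"])
  next
    case False
    have "T (1, b) (S 1 t x - x) = - T (exp t, b) (S 1 (- t) x - x)"
      unfolding neg[of 1 t] using linear_neg[OF bounded_linear.linear[OF T_bl[of "(1, b)"]]]
      by (simp add: S_subgrp_elem T_T subgrp_elem_def axb_mult_def)
    moreover have "norm (iter_diff hs' (T (exp t, b) (S 1 (- t) x - x))) \<le> B"
      using False h bK s by (intro key) (auto simp: box_def)
    ultimately show ?thesis by (simp add: linear_neg[OF lin])
  qed
  \<comment> \<open>At least K pieces make each translation at most s; at most 2K pieces keep 1 + N
    below 3K. This is the source of the 3 and of the additional power of K.\<close>
  define N where "N = nat \<lceil>K\<rceil>"
  have N: "K \<le> real N" "real N \<le> 2 * K" unfolding N_def using K by linarith+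
  define \<tau> where "\<tau> = b / real N"
  have N0: "real N > 0" using N K by linarith
  have \<tau>: "\<bar>\<tau>\<bar> \<le> s"
  proof -
    have "\<bar>b\<bar> \<le> real N * s" using h(3) N(1) s by (meson mult_right_mono order_trans less_imp_le)
    then show ?thesis using N0 by (simp add: \<tau>_def abs_divide divide_le_eq mult.commute)
  qed
  have i\<tau>: "\<bar>real i * \<tau>\<bar> \<le> K" if "i \<le> N" for i
  proof -
    have "\<bar>real i * \<tau>\<bar> \<le> real N * \<bar>\<tau>\<bar>" using that by (simp add: abs_mult mult_right_mono)
    also have "\<dots> = \<bar>b\<bar>" using N0 by (simp add: \<tau>_def abs_divide)
    finally show ?thesis using bK by simp
  qed
  have each: "norm (iter_diff hs' (S 2 (real i * \<tau>) (S 2 \<tau> x - x))) \<le> B" if "i < N" for i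
  proof (cases "\<tau> \<ge> 0")
    case True
    then show ?thesis using \<tau> i\<tau>[of i] that unfolding S_subgrp_elem[of 2 "real i * \<tau>"]
      by (intro key) (auto simp: box_def subgrp_elem_def intro!: exI[of _ "0::real"])
  next
    case False
    have "S 2 (real i * \<tau>) (S 2 \<tau> x - x) = - S 2 (real (i + 1) * \<tau>) (S 2 (- \<tau>) x - x)"
      unfolding neg[of 2 \<tau>] by (simp add: linear_neg[OF S_lin] S_S algebra_simps)
    moreover have "norm (iter_diff hs' (S 2 (real (i + 1) * \<tau>) (S 2 (- \<tau>) x - x))) \<le> B"
      using \<tau> i\<tau>[of "i + 1"] that False unfolding S_subgrp_elem[of 2 "real (i + 1) * \<tau>"]
      by (intro key) (auto simp: box_def subgrp_elem_def intro!: exI[of _ "0::real"])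
    ultimately show ?thesis by (simp add: linear_neg[OF lin])
  qed
  have "(\<Sum>i<N. S 2 (real i * \<tau>) (S 2 \<tau> x - x)) = (\<Sum>i<N. S 2 (real (Suc i) * \<tau>) x - S 2 (real i * \<tau>) x)"
    by (simp add: S_diff S_S algebra_simps)
  also have "\<dots> = S 2 b x - x"
    by (subst sum_lessThan_telescope) (use N0 in \<open>simp add: \<tau>_def\<close>)
  finally have "iter_diff hs' (S 2 b x - x) = (\<Sum>i<N. iter_diff hs' (S 2 (real i * \<tau>) (S 2 \<tau> x - x)))"
    by (metis (no_types, lifting) linear_sum[OF lin] sum.cong)
  then have part2: "norm (iter_diff hs' (S 2 b x - x)) \<le> real N * B"
    using sum_norm_le[of "{..<N}" "\<lambda>i. iter_diff hs' (S 2 (real i * \<tau>) (S 2 \<tau> x - x))" "\<lambda>_. B"] each by simp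
  \<comment> \<open>From the factorization h = (1, b)(e^t, 0).\<close>
  have "T h x - x = T (1, b) (S 1 t x - x) + (S 2 b x - x)"
    using h by (simp add: T_diff S_subgrp_elem T_T subgrp_elem_def axb_mult_def)
  moreover have "iter_diff hs x = iter_diff hs' (T h x - x)" by (simp add: hsh iter_diff_append)
  ultimately have "norm (iter_diff hs x) \<le> norm (iter_diff hs' (T (1, b) (S 1 t x - x))) + norm (iter_diff hs' (S 2 b x - x))"
    by (simp only: linear_add[OF lin] norm_triangle_ineq)
  also have "\<dots> \<le> B + real N * B" using part1 part2 by simp
  also have "\<dots> = (1 + real N) * B" by (simp add: algebra_simps)
  also have "\<dots> \<le> (3 * K) * B" using N K s0B by (intro mult_right_mono) auto
  finally show "norm (iter_diff hs x) \<le> 3 * 12 ^ p * M * K ^ (p + 1)" by (simp add: B_def mult_ac power_add)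
qed

section \<open>Box bounds from subgroup differences and from generators\<close>

lemma words_Suc: "words (Suc n) = (\<lambda>(j, js). j # js) ` ({1, 2} \<times> words n)"
  by (force simp: words_def length_Suc_conv)

lemma diff_word_append: "diff_word T (ps @ qs) x = diff_word T ps (diff_word T qs x)"
  by (induction ps) auto

lemma diff_word_iter_diff: "diff_word T (zip js ts) x = iter_diff (map2 subgrp_elem js ts) x"
proof (induction js arbitrary: ts)
  case (Cons j js) then show ?case by (cases ts) (auto simp: S_subgrp_elem)
qed simp

text \<open>The last letter acts first. Fixing it leaves the hypothesis of order n for T_j(t)x - x,
  and \<open>diff_bound_step\<close> then raises order and exponent together; hence the exponent
  equals the order.\<close>

lemma diff_bound_from_differences:
  "\<exists>C>0. \<forall>s x M. 0 < s \<longrightarrow> s \<le> 1 \<longrightarrow>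
     (\<forall>js\<in>words n. \<forall>ts. length ts = n \<longrightarrow> set ts \<subseteq> {0..s} \<longrightarrow> norm (diff_word T (zip js ts) x) \<le> M) \<longrightarrow>
     diff_bound s n n x (C * M)"
proof (induction n)
  case 0
  then show ?case by (intro exI[of _ 1]) (auto simp: words_def diff_bound_def)
next
  case (Suc n)
  then obtain C where C: "C > 0" "\<And>s x M. 0 < s \<Longrightarrow> s \<le> 1 \<Longrightarrow>
     (\<forall>js\<in>words n. \<forall>ts. length ts = n \<longrightarrow> set ts \<subseteq> {0..s} \<longrightarrow> norm (diff_word T (zip js ts) x) \<le> M) \<Longrightarrow>
     diff_bound s n n x (C * M)" by blast
  show ?case
  proof (intro exI[of _ "3 * 12 ^ n * C"] conjI allI impI)
    fix s x M assume s: "0 < s" "s \<le> (1::real)"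
      and M: "\<forall>js\<in>words (Suc n). \<forall>ts. length ts = Suc n \<longrightarrow> set ts \<subseteq> {0..s} \<longrightarrow> norm (diff_word T (zip js ts) x) \<le> M"
    have "diff_bound s (n + 1) (n + 1) x (3 * 12 ^ n * (C * M))"
    proof (rule diff_bound_step[OF _ s])
      fix j t assume j: "j \<in> {1, 2::nat}" and t: "t \<in> {0..s}"
      show "diff_bound s n n (S j t x - x) (C * M)"
      proof (rule C(2)[OF s], intro ballI allI impI)
        fix js ts assume js: "js \<in> words n" "length ts = n" "set ts \<subseteq> {0..s}"
        then have "js @ [j] \<in> words (Suc n)" using j by (auto simp: words_def)
        then have "norm (diff_word T (zip (js @ [j]) (ts @ [t])) x) \<le> M"
          using M js t by auto
        moreover have "length js = n" using js by (simp add: words_def)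
        ultimately show "norm (diff_word T (zip js ts) (S j t x - x)) \<le> M"
          using js by (simp add: diff_word_append)
      qed
    qed
    then show "diff_bound s (Suc n) (Suc n) x (3 * 12 ^ n * C * M)" by (simp add: mult_ac Suc_eq_plus1[symmetric] del: Suc_eq_plus1)
  qed (use C in simp)
qed

text \<open>\<open>gen_word\<close> recurses on the outermost generator, whereas
  \<open>word_smooth_shift\<close> peels off the innermost one, the last letter.\<close>

lemma gen_word_append: "gen_word T (js @ [j]) x =
    (case gen_word T [j] x of None \<Rightarrow> None | Some y \<Rightarrow> gen_word T js y)"
proof (induction js)
  case Nil show ?case by (simp split: option.splits)
next
  case (Cons i js)
  then show ?case by (simp del: gen_word.simps(2) add: gen_word.simps(2)[of T i] split: option.splits)
qed

text \<open>Uniqueness of the limit turns the \<open>THE\<close> of \<open>gen_word\<close> into a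
  plain relation.\<close>

lemma gen_word_Cons_iff: "gen_word T (j # js) x = Some z \<longleftrightarrow>
    (\<exists>y. gen_word T js x = Some y \<and> has_gen (S j) y z)"
  by (auto split: option.splits if_splits intro: theI2 dest: gen_unique
      simp: the_equality)

text \<open>Unlike \<open>Er\<close> this starts at k = 0, where the condition always holds, so that
  inductions on the order have a natural base.\<close>

definition word_smooth :: "nat \<Rightarrow> 'a \<Rightarrow> bool" where
  "word_smooth n x \<longleftrightarrow> (\<forall>k\<le>n. \<forall>js\<in>words k. gen_word T js x \<noteq> None)"

definition word_gen :: "nat list \<Rightarrow> 'a \<Rightarrow> 'a" where
  "word_gen js x = the (gen_word T js x)"

lemma Er_iff: "x \<in> Er T r \<longleftrightarrow> word_smooth r x"
proof -
  have "(\<forall>js\<in>words 0. gen_word T js x \<noteq> None)" by (simp add: words_def)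
  then show ?thesis unfolding Er_def word_smooth_def by (auto simp: Ball_def) (metis Suc_leI not_gr_zero One_nat_def)
qed

lemma word_smooth_Some:
  "word_smooth n x \<Longrightarrow> js \<in> words k \<Longrightarrow> k \<le> n \<Longrightarrow>
    gen_word T js x = Some (word_gen js x)"
  unfolding word_smooth_def word_gen_def by auto

lemma word_smooth_gen:
  "word_smooth n x \<Longrightarrow> js \<in> words k \<Longrightarrow> k < n \<Longrightarrow>
    j \<in> {1, 2} \<Longrightarrow> has_gen (S j) (word_gen js x) (word_gen (j # js) x)"
proof -
  assume a: "word_smooth n x" "js \<in> words k" "k < n" "j \<in> {1, 2}"
  then have "j # js \<in> words (Suc k)" by (auto simp: words_def)
  then have "gen_word T (j # js) x = Some (word_gen (j # js) x)" "gen_word T js x = Some (word_gen js x)"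
    using a by (auto intro!: word_smooth_Some simp del: gen_word.simps)
  then show ?thesis by (simp add: gen_word_Cons_iff del: gen_word.simps)
qed

lemma word_gen_Nil [simp]: "word_gen [] x = x" by (simp add: word_gen_def)

lemma word_smooth_shift:
  assumes "word_smooth (Suc n) x" "j \<in> {1, 2}"
  shows "has_gen (S j) x (word_gen [j] x)" "word_smooth n (word_gen [j] x)" "\<And>k js. k \<le> n \<Longrightarrow> js \<in> words k \<Longrightarrow> word_gen js (word_gen [j] x) = word_gen (js @ [j]) x"
proof -
  show 1: "has_gen (S j) x (word_gen [j] x)"
    using word_smooth_gen[OF assms(1), of "[]" 0 j] assms by (simp add: words_def)
  have *: "gen_word T [j] x = Some (word_gen [j] x)"
    using assms by (intro word_smooth_Some[of "Suc n" _ _ 1]) (auto simp: words_def)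
  have **: "gen_word T js (word_gen [j] x) = gen_word T (js @ [j]) x" for js
    using * by (simp add: gen_word_append del: gen_word.simps)
  show "word_gen js (word_gen [j] x) = word_gen (js @ [j]) x" for js
    by (simp only: word_gen_def[of js] word_gen_def[of "js @ [j]"] **)
  show "word_smooth n (word_gen [j] x)"
    unfolding word_smooth_def **
  proof (intro allI impI ballI)
    fix k js assume "k \<le> n" "js \<in> words k"
    then have "js @ [j] \<in> words (Suc k)" "Suc k \<le> Suc n" using assms by (auto simp: words_def)
    then show "gen_word T (js @ [j]) x \<noteq> None" using assms(1) unfolding word_smooth_def by blast
  qed
qed

text \<open>For the lower estimate. T_j(t)x - x is the integral of T_j(u)A_j x over [0,t]: the
  integration gains s, passing T_j(u) costs 12^n, and the induction hypothesis applies to A_j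
  x.\<close>

lemma diff_bound_from_generators:
  "\<exists>C>0. \<forall>s x M. 0 < s \<longrightarrow> s \<le> 1 \<longrightarrow> word_smooth n x \<longrightarrow> (\<forall>js\<in>words n. norm (word_gen js x) \<le> M) \<longrightarrow>
     diff_bound s n n x (C * s ^ n * M)"
proof (induction n)
  case 0
  then show ?case by (intro exI[of _ 1]) (auto simp: words_def diff_bound_def)
next
  case (Suc n)
  then obtain C where C: "C > 0" "\<And>s x M. 0 < s \<Longrightarrow> s \<le> 1 \<Longrightarrow> word_smooth n x \<Longrightarrow>
     (\<forall>js\<in>words n. norm (word_gen js x) \<le> M) \<Longrightarrow> diff_bound s n n x (C * s ^ n * M)" by blast
  show ?case
  proof (intro exI[of _ "3 * 12 ^ n * (12 ^ n * C)"] conjI allI impI)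
    fix s x M assume s: "0 < s" "s \<le> (1::real)" and x: "word_smooth (Suc n) x"
      and M: "\<forall>js\<in>words (Suc n). norm (word_gen js x) \<le> M"
    let ?B = "12 ^ n * (C * s ^ n * M)"
    have "diff_bound s (n + 1) (n + 1) x (3 * 12 ^ n * (s * ?B))"
    proof (rule diff_bound_step[OF _ s])
      fix j t assume j: "j \<in> {1, 2::nat}" and t: "t \<in> {0..s}"
      have diff_bound: "diff_bound s n n (word_gen [j] x) (C * s ^ n * M)"
      proof (rule C(2)[OF s word_smooth_shift(2)[OF x j]], intro ballI)
        fix js assume "js \<in> words n"
        moreover then have "js @ [j] \<in> words (Suc n)" using j by (auto simp: words_def)
        ultimately show "norm (word_gen js (word_gen [j] x)) \<le> M" using M word_smooth_shift(3)[OF x j, of n js] by simp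
      qed
      have "diff_bound s n n (integral {0..t} (\<lambda>u. S j u (word_gen [j] x))) ((t - 0) * ?B)"
        using s t by (intro diff_bound_integral continuous_intros diff_bound_S diff_bound) auto
      moreover have "S j t x - x = integral {0..t} (\<lambda>u. S j u (word_gen [j] x))"
        using t by (intro gen_integral word_smooth_shift(1)[OF x j]) auto
      moreover have "(t - 0) * ?B \<le> s * ?B"
        using t diff_bound_nonneg[OF diff_bound] s by (intro mult_right_mono) auto
      ultimately show "diff_bound s n n (S j t x - x) (s * ?B)" using diff_bound_mono by metis
    qed
    then show "diff_bound s (Suc n) (Suc n) x (3 * 12 ^ n * (12 ^ n * C) * s ^ Suc n * M)" by (simp add: mult_ac Suc_eq_plus1[symmetric] del: Suc_eq_plus1)
  qed (use C in simp)
qed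

subsection \<open>Derivatives of intermediate order\<close>

text \<open>First-order Taylor expansion: ty is T_j(t)x - x minus the integral of T_j(u)y - y, whose
  integrand is at most t||z||.\<close>

lemma landau:
  assumes 1: "has_gen (S j) x y" and 2: "has_gen (S j) y z" and t: "t > 0"
  shows "norm y \<le> 2 / t * norm x + t * norm z"
proof -
  have n: "norm (S j u y - y) \<le> t * norm z" if "u \<in> {0..t}" for u
  proof -
    have "norm (S j u y - y) = norm (integral {0..u} (\<lambda>v. S j v z))"
      using gen_integral[OF 2] that by simp
    also have "\<dots> \<le> norm z * (u - 0)"
      using that by (intro integral_bound continuous_intros S_norm) auto
    also have "\<dots> \<le> t * norm z" using that by (simp add: mult.commute mult_right_mono)
    finally show ?thesis .
  qed
  have "t *\<^sub>R y = integral {0..t} (\<lambda>u. y)" using t by simp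
  also have "\<dots> = integral {0..t} (\<lambda>u. S j u y - (S j u y - y))" by simp
  also have "\<dots> = integral {0..t} (\<lambda>u. S j u y) - integral {0..t} (\<lambda>u. S j u y - y)"
    by (intro integral_diff integrable_continuous_real continuous_intros)
  also have "\<dots> = S j t x - x - integral {0..t} (\<lambda>u. S j u y - y)"
    using gen_integral[OF 1] t by simp
  finally have "t * norm y = norm (S j t x - x - integral {0..t} (\<lambda>u. S j u y - y))"
    using t by (metis abs_of_pos norm_scaleR)
  also have "\<dots> \<le> norm (S j t x) + norm x + norm (integral {0..t} (\<lambda>u. S j u y - y))"
    by (meson add_mono norm_triangle_ineq4 order_refl order_trans)
  also have "\<dots> \<le> norm x + norm x + t * norm z * (t - 0)"
    using t by (intro add_mono S_norm order_refl integral_bound n continuous_intros) auto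
  finally have "t * norm y \<le> t * (2 / t * norm x + t * norm z)"
    using t by (simp add: algebra_simps)
  then show ?thesis using t by simp
qed

lemma words_0: "words 0 = {[]}"
  by (auto simp: words_def)

lemma finite_words [simp]: "finite (words n)"
proof (induction n)
  case 0 show ?case by (simp add: words_def)
next
  case (Suc n) then show ?case by (simp add: words_Suc)
qed

lemma sum_words_Suc:
  "(\<Sum>js\<in>words (Suc n). f js) = (\<Sum>js\<in>words n. f (1 # js) + f (2 # js) :: real)"
proof -
  have "(\<Sum>js\<in>words (Suc n). f js) = (\<Sum>(j, js)\<in>{1, 2} \<times> words n. f (j # js))"
    unfolding words_Suc by (subst sum.reindex) (auto simp: inj_on_def split_def)
  also have "\<dots> = (\<Sum>j\<in>{1, 2}. \<Sum>js\<in>words n. f (j # js))"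
    by (simp add: sum.cartesian_product)
  finally show ?thesis by (simp add: sum.distrib)
qed

lemma Er_norm_le:
  "\<exists>C>0. \<forall>x. word_smooth r x \<longrightarrow> Er_norm T r x \<le> C * (norm x + (\<Sum>js\<in>words r. norm (word_gen js x)))"
proof -
  obtain C where C: "C > 0" "\<And>a :: nat \<Rightarrow> real. (\<forall>k. 0 \<le> a k) \<Longrightarrow>
     (\<forall>k t. Suc (Suc k) \<le> r \<longrightarrow> 0 < t \<longrightarrow> a (Suc k) \<le> 4 / t * a k + t * a (Suc (Suc k))) \<Longrightarrow>
     (\<forall>k\<le>r. a k \<le> C * (a 0 + a r))" using sequence_interpolation[of r] by blast
  have "Er_norm T r x \<le> (1 + r * C) * (norm x + (\<Sum>js\<in>words r. norm (word_gen js x)))" if x: "word_smooth r x" for x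
  proof -
    define a where "a k = (\<Sum>js\<in>words k. norm (word_gen js x))" for k
    have a0: "a 0 = norm x" by (simp add: a_def words_0)
    have nn: "\<forall>k. 0 \<le> a k" by (simp add: a_def sum_nonneg)
    have "\<forall>k\<le>r. a k \<le> C * (a 0 + a r)"
    proof (rule C(2)[OF nn], intro allI impI)
      fix k and t :: real assume k: "Suc (Suc k) \<le> r" and t: "0 < t"
      have L: "norm (word_gen (j # js) x) \<le> 2 / t * norm (word_gen js x) + t * norm (word_gen (j # j # js) x)"
        if "js \<in> words k" "j \<in> {1, 2}" for js j
      proof (rule landau[OF _ _ t])
        show "has_gen (S j) (word_gen js x) (word_gen (j # js) x)" using that k by (intro word_smooth_gen[OF x, of _ k]) auto
        have "j # js \<in> words (Suc k)" using that by (auto simp: words_def)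
        then show "has_gen (S j) (word_gen (j # js) x) (word_gen (j # j # js) x)"
          using that k by (intro word_smooth_gen[OF x, of _ "Suc k"]) auto
      qed
      have "a (Suc k) = (\<Sum>js\<in>words k. norm (word_gen (1 # js) x) + norm (word_gen (2 # js) x))"
        unfolding a_def using sum_words_Suc[of "\<lambda>js. norm (word_gen js x)" k] by simp
      also have "\<dots> \<le> (\<Sum>js\<in>words k. (2 / t * norm (word_gen js x) + t * norm (word_gen (1 # 1 # js) x)) +
           (2 / t * norm (word_gen js x) + t * norm (word_gen (2 # 2 # js) x)))"
        by (intro sum_mono add_mono L) auto
      \<comment> \<open>Landau yields only words with a repeated letter; the mixed ones are added to
        complete the sum over \<open>words (Suc (Suc k))\<close>.\<close>
      also have "\<dots> \<le> (\<Sum>js\<in>words k. 4 / t * norm (word_gen js x) +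
          t * ((norm (word_gen (1 # 1 # js) x) + norm (word_gen (2 # 1 # js) x)) + (norm (word_gen (1 # 2 # js) x) + norm (word_gen (2 # 2 # js) x))))"
        using t by (intro sum_mono) (simp add: distrib_left)
      also have "\<dots> = 4 / t * a k + t * a (Suc (Suc k))"
        unfolding a_def using sum_words_Suc[of "\<lambda>js. norm (word_gen js x)" "Suc k"]
        by (simp add: sum_words_Suc sum.distrib distrib_left sum_distrib_left)
      finally show "a (Suc k) \<le> 4 / t * a k + t * a (Suc (Suc k))" .
    qed
    then have "(\<Sum>k=1..r. a k) \<le> (\<Sum>k=1..r. C * (a 0 + a r))" by (intro sum_mono) auto
    also have "\<dots> = r * C * (a 0 + a r)" by simp
    finally have "(\<Sum>k=1..r. a k) \<le> r * C * (a 0 + a r)" .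
    moreover have "Er_norm T r x = a 0 + (\<Sum>k=1..r. a k)"
      unfolding Er_norm_def a0 by (simp add: a_def word_gen_def)
    moreover have "0 \<le> a r" using nn by simp
    ultimately have "Er_norm T r x \<le> (1 + r * C) * (a 0 + a r)" by (simp add: algebra_simps)
    then show ?thesis by (simp add: a_def words_0)
  qed
  then show ?thesis using C(1) by (intro exI[of _ "1 + r * C"]) (auto simp: add_pos_nonneg)
qed

subsection \<open>Averages over the group\<close>

definition avg :: "nat \<Rightarrow> (real \<Rightarrow> real) \<Rightarrow> real \<Rightarrow> 'a \<Rightarrow> 'a" where
  "avg j \<alpha> s x = integral {0..s} (\<lambda>u. \<alpha> u *\<^sub>R S j u x)"

lemma avg_add:
  assumes "continuous_on {0..s} \<alpha>"
  shows "avg j \<alpha> s (x + y) = avg j \<alpha> s x + avg j \<alpha> s y"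
  unfolding avg_def S_add scaleR_add_right
  by (intro integral_add integrable_continuous_real continuous_intros assms)

lemma avg_scale: "avg j \<alpha> s (c *\<^sub>R x) = c *\<^sub>R avg j \<alpha> s x"
  unfolding avg_def S_scale by (simp add: mult.commute flip: integral_cmul)

lemma diff_bound_avg:
  assumes "diff_bound s p n x M" "continuous_on {0..s} \<alpha>" "\<And>u. u \<in> {0..s} \<Longrightarrow> \<bar>\<alpha> u\<bar> \<le> 1" "0 < s" "s \<le> 1"
  shows "diff_bound s p n (avg j \<alpha> s x) (s * (12 ^ p * M))"
proof -
  have "diff_bound s p n (\<alpha> u *\<^sub>R S j u x) (12 ^ p * M)" if u: "u \<in> {0..s}" for u
  proof (rule diff_bound_mono[OF diff_bound_scale[OF diff_bound_S[OF assms(1)]]])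
    show "\<bar>\<alpha> u\<bar> * (12 ^ p * M) \<le> 12 ^ p * M"
      using assms(3)[OF u] diff_bound_nonneg[OF assms(1)] assms(4) by (intro mult_left_le_one_le) auto
  qed (use u assms in auto)
  then have "diff_bound s p n (avg j \<alpha> s x) ((s - 0) * (12 ^ p * M))"
    unfolding avg_def using assms by (intro diff_bound_integral continuous_intros) auto
  then show ?thesis by simp
qed

text \<open>With \<open>pow_weight\<close>: the powers of the factors e^(-t) and u that commuting a
  generator with the averages produces. All are at most 1 on [0,1].\<close>

definition exp_weight :: "nat \<Rightarrow> real \<Rightarrow> real" where "exp_weight a t = exp (- (real a * t))"
definition pow_weight :: "nat \<Rightarrow> real \<Rightarrow> real" where "pow_weight b u = u ^ b"

lemma w_cont [continuous_intros]: "continuous_on A (exp_weight a)" "continuous_on A (pow_weight b)"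
  unfolding exp_weight_def pow_weight_def by (intro continuous_intros)+

lemma w_bound:
  "u \<in> {0..s} \<Longrightarrow> s \<le> 1 \<Longrightarrow>
    \<bar>exp_weight a u\<bar> \<le> 1" "u \<in> {0..s} \<Longrightarrow> s \<le> 1 \<Longrightarrow>
    \<bar>pow_weight b u\<bar> \<le> 1"
  by (auto simp: exp_weight_def pow_weight_def power_le_one)

text \<open>\<open>mollify 0 0 s\<close> is P; the other members arise when generators move through
  it.\<close>

definition mollify :: "nat \<Rightarrow> nat \<Rightarrow> real \<Rightarrow> 'a \<Rightarrow> 'a" where
  "mollify a b s x = (1 / s\<^sup>2) *\<^sub>R avg 1 (exp_weight a) s (avg 2 (pow_weight b) s x)"

lemma mollify_add: "mollify a b s (x + y) = mollify a b s x + mollify a b s y"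
  by (simp add: mollify_def avg_add w_cont scaleR_add_right)

lemma mollify_diff: "mollify a b s (x - y) = mollify a b s x - mollify a b s y"
  using mollify_add[of a b s "x - y" y] by simp

lemma diff_bound_mollify:
  assumes "diff_bound s p n x M" "0 < s" "s \<le> 1"
  shows "diff_bound s p n (mollify a b s x) (144 ^ p * M)"
proof -
  have "diff_bound s p n (mollify a b s x) (\<bar>1 / s\<^sup>2\<bar> * (s * (12 ^ p * (s * (12 ^ p * M)))))"
    unfolding mollify_def by (intro diff_bound_scale diff_bound_avg w_cont w_bound) (use assms in auto)
  also have "\<bar>1 / s\<^sup>2\<bar> * (s * (12 ^ p * (s * (12 ^ p * M)))) = 144 ^ p * M"
    using assms by (simp add: power2_eq_square field_simps flip: power_mult_distrib)
  finally show ?thesis .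
qed

lemma gen_S:
  assumes "has_gen (S j) x y" shows "has_gen (S j) (S j u x) (S j u y)"
proof -
  have "((\<lambda>t. S j u ((S j t x - x) /\<^sub>R t)) \<longlongrightarrow> S j u y) (at_right 0)"
    using assms unfolding has_gen_def by (intro tendsto_S tendsto_const)
  then show ?thesis by (simp add: has_gen_def S_scale S_diff S_S add.commute)
qed

lemma gen_avg:
  assumes "has_gen (S j) x y" "continuous_on {0..s} \<alpha>"
  shows "has_gen (S j) (avg j \<alpha> s x) (avg j \<alpha> s y)"
  unfolding avg_def using assms by (intro gen_closed gen_scale gen_S continuous_intros)

lemma gen1_avg2:
  assumes "has_gen (S 1) x x1" "has_gen (S 2) x x2"
  shows "has_gen (S 1) (avg 2 (pow_weight b) s x) (avg 2 (pow_weight b) s x1 + avg 2 (pow_weight (b + 1)) s x2)"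
proof -
  have "has_gen (S 1) (avg 2 (pow_weight b) s x) (integral {0..s} (\<lambda>u. pow_weight b u *\<^sub>R (S 2 u x1 + u *\<^sub>R S 2 u x2)))"
    unfolding avg_def using assms by (intro gen_closed gen_scale gen1_S2 continuous_intros) auto
  also have "integral {0..s} (\<lambda>u. pow_weight b u *\<^sub>R (S 2 u x1 + u *\<^sub>R S 2 u x2)) =
     integral {0..s} (\<lambda>u. pow_weight b u *\<^sub>R S 2 u x1 + pow_weight (b + 1) u *\<^sub>R S 2 u x2)"
    by (simp add: scaleR_add_right pow_weight_def mult.commute power_add)
  also have "\<dots> = avg 2 (pow_weight b) s x1 + avg 2 (pow_weight (b + 1)) s x2"
    unfolding avg_def by (intro integral_add integrable_continuous_real continuous_intros)
  finally show ?thesis .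
qed

lemma gen2_avg1:
  assumes "has_gen (S 2) x x2"
  shows "has_gen (S 2) (avg 1 (exp_weight a) s x) (avg 1 (exp_weight (a + 1)) s x2)"
proof -
  have "has_gen (S 2) (avg 1 (exp_weight a) s x) (integral {0..s} (\<lambda>u. exp_weight a u *\<^sub>R (exp (- u) *\<^sub>R S 1 u x2)))"
    unfolding avg_def using assms by (intro gen_closed gen_scale gen2_S1 continuous_intros) auto
  also have "integral {0..s} (\<lambda>u. exp_weight a u *\<^sub>R (exp (- u) *\<^sub>R S 1 u x2)) = avg 1 (exp_weight (a + 1)) s x2"
    unfolding avg_def by (simp add: exp_weight_def algebra_simps flip: exp_add)
  finally show ?thesis .
qed

lemma gen1_mollify:
  assumes "has_gen (S 1) x x1" "has_gen (S 2) x x2"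
  shows "has_gen (S 1) (mollify a b s x) (mollify a b s x1 + mollify a (b + 1) s x2)"
  unfolding mollify_def scaleR_add_right[symmetric] avg_add[OF w_cont(1), symmetric]
  by (intro gen_scale gen_avg gen1_avg2 assms w_cont)

lemma gen2_mollify:
  assumes "has_gen (S 2) x x2"
  shows "has_gen (S 2) (mollify a b s x) (mollify (a + 1) b s x2)"
  unfolding mollify_def by (intro gen_scale gen2_avg1 gen_avg assms w_cont)

text \<open>Estimates the value supplied by \<open>gen_weighted\<close>, at the price of one order:
  the boundary term contributes 1, the integral over a length s \<le> 1 contributes c.\<close>

lemma diff_bound_weighted_difference:
  assumes x: "diff_bound s p (n + 1) x M" and s: "0 < s" "s \<le> 1" and "\<bar>\<alpha> s\<bar> \<le> 1"
    and c: "continuous_on {0..s} \<alpha>'" "\<And>u. u \<in> {0..s} \<Longrightarrow> \<bar>\<alpha>' u\<bar> \<le> c"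
  shows "diff_bound s p n (\<alpha> s *\<^sub>R (S j s x - x) - integral {0..s} (\<lambda>u. \<alpha>' u *\<^sub>R (S j u x - x))) ((1 + c) * M)"
proof -
  have M: "0 \<le> M" using diff_bound_nonneg[OF x] s by simp
  have D: "diff_bound s p n (S j u x - x) M" if "u \<in> {0..s}" for u
    unfolding S_subgrp_elem using that s by (intro diff_bound_D[OF x] subgrp_elem_box) auto
  have "diff_bound s p n (\<alpha>' u *\<^sub>R (S j u x - x)) (c * M)" if u: "u \<in> {0..s}" for u
    using c(2)[OF u] M by (intro diff_bound_mono[OF diff_bound_scale[OF D[OF u]]] mult_right_mono)
  then have "diff_bound s p n (integral {0..s} (\<lambda>u. \<alpha>' u *\<^sub>R (S j u x - x))) ((s - 0) * (c * M))"
    using s by (intro diff_bound_integral continuous_intros c) auto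
  moreover have "diff_bound s p n (\<alpha> s *\<^sub>R (S j s x - x)) (\<bar>\<alpha> s\<bar> * M)"
    using s by (intro diff_bound_scale D) auto
  ultimately have "diff_bound s p n (\<alpha> s *\<^sub>R (S j s x - x) - integral {0..s} (\<lambda>u. \<alpha>' u *\<^sub>R (S j u x - x)))
      (\<bar>\<alpha> s\<bar> * M + (s - 0) * (c * M))" by (rule diff_bound_diff[rotated])
  moreover have "\<bar>\<alpha> s\<bar> * M \<le> 1 * M" using assms(4) M by (rule mult_right_mono)
  moreover have "0 \<le> c" using c(2)[of 0] s by auto
  then have "(s - 0) * (c * M) \<le> 1 * (c * M)" using s M by (intro mult_right_mono) auto
  ultimately show ?thesis by (auto simp: distrib_right elim: diff_bound_mono)
qed

text \<open>
  The weights satisfy no boundary conditions; the total mass of the resulting kernel still vanishes, so only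
  differences occur.
\<close>

lemma mollify_smooth:
  assumes s: "0 < s" "s \<le> 1" and j: "j \<in> {1, 2}"
  shows "\<exists>y. has_gen (S j) (mollify a b s x) y \<and>
     (\<forall>n M. diff_bound s p (n + 1) x M \<longrightarrow> diff_bound s p n y (12 ^ p * (1 + real a + real b) / s * M))"
proof (cases "j = 1")
  case True
  let ?X = "avg 2 (pow_weight b) s x"
  let ?\<alpha>' = "\<lambda>u. - (real a * exp (- (real a * u)))"
  let ?y = "exp_weight a s *\<^sub>R (S 1 s ?X - ?X) - integral {0..s} (\<lambda>u. ?\<alpha>' u *\<^sub>R (S 1 u ?X - ?X))"
  have "has_gen (S 1) (avg 1 (exp_weight a) s ?X) ?y"
    unfolding avg_def[of 1] using s
    by (intro gen_weighted) (auto simp: exp_weight_def intro!: derivative_eq_intros continuous_intros)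
  then have "has_gen (S 1) (mollify a b s x) ((1 / s\<^sup>2) *\<^sub>R ?y)"
    unfolding mollify_def by (rule gen_scale)
  moreover have "diff_bound s p n ((1 / s\<^sup>2) *\<^sub>R ?y) (12 ^ p * (1 + real a + real b) / s * M)" if M: "diff_bound s p (n + 1) x M" for n M
  proof -
    have "diff_bound s p (n + 1) ?X (s * (12 ^ p * M))"
      by (intro diff_bound_avg w_cont w_bound) (use M s in auto)
    then have "diff_bound s p n ?y ((1 + real a) * (s * (12 ^ p * M)))"
      using s by (intro diff_bound_weighted_difference w_bound) (auto intro!: continuous_intros mult_left_le)
    then have "diff_bound s p n ((1 / s\<^sup>2) *\<^sub>R ?y) (\<bar>1 / s\<^sup>2\<bar> * ((1 + real a) * (s * (12 ^ p * M))))"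
      by (rule diff_bound_scale)
    \<comment> \<open>Only one average still contributes a length s against s^(-2), which leaves
      1/s.\<close>
    moreover have "\<bar>1 / s\<^sup>2\<bar> * ((1 + real a) * (s * (12 ^ p * M))) = (1 + real a) * (12 ^ p * M / s)"
      using s by (simp add: power2_eq_square field_simps)
    moreover have "\<dots> \<le> (1 + real a + real b) * (12 ^ p * M / s)"
      using s diff_bound_nonneg[OF M] by (intro mult_right_mono) auto
    ultimately show ?thesis by (auto elim!: diff_bound_mono simp: mult_ac)
  qed
  ultimately show ?thesis using True by blast
next
  case False
  then have j2: "j = 2" using j by simp
  let ?\<alpha>' = "\<lambda>u. real b * u ^ (b - 1)"
  let ?z = "pow_weight b s *\<^sub>R (S 2 s x - x) - integral {0..s} (\<lambda>u. ?\<alpha>' u *\<^sub>R (S 2 u x - x))"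
  \<comment> \<open>A_2 passes the outer average over T_1, which raises \<open>a\<close> by one,
    before it meets the inner average.\<close>
  let ?y = "avg 1 (exp_weight (a + 1)) s ?z"
  have "has_gen (S 2) (avg 2 (pow_weight b) s x) ?z"
    unfolding avg_def using s
    by (intro gen_weighted) (auto simp: pow_weight_def One_nat_def intro!: derivative_eq_intros continuous_intros)
  then have "has_gen (S 2) (mollify a b s x) ((1 / s\<^sup>2) *\<^sub>R ?y)"
    unfolding mollify_def by (intro gen_scale gen2_avg1)
  moreover have "diff_bound s p n ((1 / s\<^sup>2) *\<^sub>R ?y) (12 ^ p * (1 + real a + real b) / s * M)" if M: "diff_bound s p (n + 1) x M" for n M
  proof -
    have "diff_bound s p n ?z ((1 + real b) * M)"
      using s by (intro diff_bound_weighted_difference w_bound M)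
        (auto intro!: continuous_intros mult_left_le power_le_one)
    then have "diff_bound s p n ?y (s * (12 ^ p * ((1 + real b) * M)))"
      by (intro diff_bound_avg w_cont w_bound) (use s in auto)
    then have "diff_bound s p n ((1 / s\<^sup>2) *\<^sub>R ?y) (\<bar>1 / s\<^sup>2\<bar> * (s * (12 ^ p * ((1 + real b) * M))))"
      by (rule diff_bound_scale)
    moreover have "\<bar>1 / s\<^sup>2\<bar> * (s * (12 ^ p * ((1 + real b) * M))) = (1 + real b) * (12 ^ p * M / s)"
      using s by (simp add: power2_eq_square field_simps)
    moreover have "\<dots> \<le> (1 + real a + real b) * (12 ^ p * M / s)"
      using s diff_bound_nonneg[OF M] by (intro mult_right_mono) auto
    ultimately show ?thesis by (auto elim!: diff_bound_mono simp: mult_ac)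
  qed
  ultimately show ?thesis using j2 by blast
qed

text \<open>
  The commutation rules $\mathbb A_1T_2(u) = T_2(u)(\mathbb A_1 + u\mathbb A_2)$ and
  $\mathbb A_2T_1(t) = e^{-t}T_1(t)\mathbb A_2$ raise the exponents of the weights; a triple $(a,b,w)$
  stands for the average with weight $e^{-at}u^b$ applied to $\mathbb A_w x$.
\<close>

definition mollify_sum :: "real \<Rightarrow> (nat \<times> nat \<times> nat list) list \<Rightarrow> 'a \<Rightarrow> 'a" where
  "mollify_sum s L x = (\<Sum>(a, b, js)\<leftarrow>L. mollify a b s (word_gen js x))"

fun commute_letter :: "nat \<Rightarrow> nat \<times> nat \<times> nat list \<Rightarrow> (nat \<times> nat \<times> nat list) list" where
  "commute_letter j (a, b, js) = (if j = 1 then [(a, b, 1 # js), (a, b + 1, 2 # js)] else [(a + 1, b, 2 # js)])"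

fun commute_words :: "nat list \<Rightarrow> nat \<Rightarrow> nat \<Rightarrow> (nat \<times> nat \<times> nat list) list" where
  "commute_words [] a b = [(a, b, [])]"
| "commute_words (j # js) a b = concat (map (commute_letter j) (commute_words js a b))"

lemma commute_words_words:
  "(a', b', js') \<in> set (commute_words js a b) \<Longrightarrow> js' \<in> words (length js)"
proof (induction js arbitrary: a' b' js')
  case (Cons j js)
  then show ?case by (fastforce simp: words_def split: if_splits)
qed (simp add: words_0)

lemma mollify_sum_append: "mollify_sum s (L @ L') x = mollify_sum s L x + mollify_sum s L' x"
  by (simp add: mollify_sum_def)

lemma gen_mollify_sum:
  assumes "word_smooth (Suc k) x" "j \<in> {1, 2}" "\<forall>(a, b, js)\<in>set L. js \<in> words k"
  shows "has_gen (S j) (mollify_sum s L x) (mollify_sum s (concat (map (commute_letter j) L)) x)"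
  using assms(3)
proof (induction L)
  case Nil show ?case by (simp add: mollify_sum_def gen_0)
next
  case (Cons l L)
  obtain a b js where l: "l = (a, b, js)" by (cases l)
  then have js: "js \<in> words k" using Cons by simp
  have g: "has_gen (S 1) (word_gen js x) (word_gen (1 # js) x)" "has_gen (S 2) (word_gen js x) (word_gen (2 # js) x)"
    using js by (auto intro!: word_smooth_gen[OF assms(1), of _ k])
  have "has_gen (S j) (mollify a b s (word_gen js x)) (mollify_sum s (commute_letter j l) x)"
    using assms(2) gen1_mollify[OF g, of a b s] gen2_mollify[OF g(2), of a b s] by (auto simp: l mollify_sum_def)
  moreover have "mollify_sum s (l # L) x = mollify a b s (word_gen js x) + mollify_sum s L x" by (simp add: mollify_sum_def l)
  ultimately show ?case using gen_add[OF _ Cons.IH] Cons.prems by (simp add: mollify_sum_append)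
qed

lemma word_smooth_mono:
  "word_smooth n x \<Longrightarrow> m \<le> n \<Longrightarrow> word_smooth m x"
  unfolding word_smooth_def by (meson order_trans)

lemma gen_word_mollify:
  "word_smooth (length js) x \<Longrightarrow> set js \<subseteq> {1, 2} \<Longrightarrow>
    gen_word T js (mollify a b s x) = Some (mollify_sum s (commute_words js a b) x)"
proof (induction js)
  case Nil then show ?case by (simp add: mollify_sum_def)
next
  case (Cons j js)
  have "gen_word T js (mollify a b s x) = Some (mollify_sum s (commute_words js a b) x)"
    using Cons word_smooth_mono[of "length (j # js)" x "length js"] by auto
  moreover have "has_gen (S j) (mollify_sum s (commute_words js a b) x) (mollify_sum s (commute_words (j # js) a b) x)"
    using gen_mollify_sum[of "length js" x j "commute_words js a b" s] Cons.prems commute_words_words by fastforce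
  ultimately show ?case unfolding gen_word_Cons_iff by blast
qed

lemma mollify_sum_smooth:
  assumes s: "0 < s" "s \<le> 1" and j: "j \<in> {1, 2}" and "\<forall>(a, b, js)\<in>set L. js \<in> words k"
  shows "\<exists>y. has_gen (S j) (mollify_sum s L x) y \<and> (\<forall>n M. (\<forall>js\<in>words k. diff_bound s p (n + 1) (word_gen js x) M) \<longrightarrow>
       diff_bound s p n y ((\<Sum>(a, b, js)\<leftarrow>L. 12 ^ p * (1 + real a + real b)) / s * M))"
  using assms(4)
proof (induction L)
  case Nil show ?case by (intro exI[of _ 0]) (simp add: mollify_sum_def gen_0 diff_bound_zero)
next
  case (Cons l L)
  then obtain y where y: "has_gen (S j) (mollify_sum s L x) y"
    "\<And>n M. (\<forall>js\<in>words k. diff_bound s p (n + 1) (word_gen js x) M) \<Longrightarrow>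
       diff_bound s p n y ((\<Sum>(a, b, js)\<leftarrow>L. 12 ^ p * (1 + real a + real b)) / s * M)" by auto
  obtain a b js where l: "l = (a, b, js)" by (cases l)
  then have js: "js \<in> words k" using Cons by simp
  obtain z where z: "has_gen (S j) (mollify a b s (word_gen js x)) z"
    "\<And>n M. diff_bound s p (n + 1) (word_gen js x) M \<Longrightarrow> diff_bound s p n z (12 ^ p * (1 + real a + real b) / s * M)"
    using mollify_smooth[OF s j, of a b "word_gen js x" p] by blast
  have "has_gen (S j) (mollify_sum s (l # L) x) (z + y)"
    using gen_add[OF z(1) y(1)] by (simp add: mollify_sum_def l)
  moreover have "diff_bound s p n (z + y) ((\<Sum>(a, b, js)\<leftarrow>l # L. 12 ^ p * (1 + real a + real b)) / s * M)"
    if "\<forall>js\<in>words k. diff_bound s p (n + 1) (word_gen js x) M" for n M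
    using diff_bound_add[OF z(2) y(2)[OF that]] that js by (simp add: l distrib_right add_divide_distrib)
  ultimately show ?case by blast
qed

text \<open>The gain of one order of smoothness: the k inner letters are commuted onto x, and the
  outermost one falls on the averages themselves, costing 1/s and one difference.\<close>

lemma mollify_word:
  assumes js: "js \<in> words (Suc k)"
  shows "\<exists>c\<ge>0. \<forall>s x. 0 < s \<longrightarrow> s \<le> 1 \<longrightarrow> word_smooth k x \<longrightarrow> (\<exists>y. gen_word T js (mollify a b s x) = Some y \<and>
     (\<forall>n M. (\<forall>js'\<in>words k. diff_bound s p (n + 1) (word_gen js' x) M) \<longrightarrow> diff_bound s p n y (c / s * M)))"
proof -
  obtain j js1 where js1: "js = j # js1" "j \<in> {1, 2}" "js1 \<in> words k"
    using js by (auto simp: words_Suc)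
  then have l: "length js1 = k" "set js1 \<subseteq> {1, 2}" by (auto simp: words_def)
  let ?L = "commute_words js1 a b"
  have L: "\<forall>(a, b, js)\<in>set ?L. js \<in> words k" using commute_words_words l by auto
  show ?thesis
  proof (intro exI[of _ "\<Sum>(a, b, js)\<leftarrow>?L. 12 ^ p * (1 + real a + real b)"] conjI allI impI)
    show "0 \<le> (\<Sum>(a, b, js)\<leftarrow>?L. 12 ^ p * (1 + real a + real b))"
      by (intro sum_list_nonneg) auto
  next
    fix s x assume s: "0 < s" "s \<le> (1::real)" and x: "word_smooth k x"
    have 1: "gen_word T js1 (mollify a b s x) = Some (mollify_sum s ?L x)" using x l by (intro gen_word_mollify) auto
    show "\<exists>y. gen_word T js (mollify a b s x) = Some y \<and> (\<forall>n M. (\<forall>js'\<in>words k. diff_bound s p (n + 1) (word_gen js' x) M) \<longrightarrow>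
         diff_bound s p n y ((\<Sum>(a, b, js)\<leftarrow>?L. 12 ^ p * (1 + real a + real b)) / s * M))"
      unfolding js1(1) gen_word_Cons_iff using mollify_sum_smooth[OF s js1(2) L, of x p] 1 by blast
  qed
qed

lemma word_smooth_mollify:
  assumes "word_smooth k x" "0 < s" "s \<le> 1" shows "word_smooth (Suc k) (mollify a b s x)"
  unfolding word_smooth_def
proof (intro allI impI ballI)
  fix k' js assume k': "k' \<le> Suc k" "js \<in> words k'"
  show "gen_word T js (mollify a b s x) \<noteq> None"
  proof (cases k')
    case 0 then show ?thesis using k' by (simp add: words_0)
  next
    case (Suc k2)
    then show ?thesis
      using mollify_word[of js k2 a b 0] k' assms word_smooth_mono[OF assms(1), of k2] by fastforce
  qed
qed

lemma word_smooth_mollify_power: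
  "0 < s \<Longrightarrow> s \<le> 1 \<Longrightarrow> word_smooth k ((mollify 0 0 s ^^ k) x)"
proof (induction k)
  case 0 show ?case by (simp add: word_smooth_def words_0)
qed (simp add: word_smooth_mollify)

text \<open>Each P turns one available difference into one generator at the price 1/s.
  \<open>n\<close> is quantified inside because the induction hypothesis is used at n + 1.\<close>

lemma diff_bound_mollify_power:
  "\<exists>C\<ge>0. \<forall>s x n M. 0 < s \<longrightarrow> s \<le> 1 \<longrightarrow> diff_bound s p (n + k) x M \<longrightarrow>
     (\<forall>js\<in>words k. diff_bound s p n (word_gen js ((mollify 0 0 s ^^ k) x)) (C / s ^ k * M))"
proof (induction k)
  case 0
  show ?case by (intro exI[of _ 1]) (auto simp: words_0)
next
  case (Suc k)
  then obtain C where C: "C \<ge> 0" "\<And>s x n M js. 0 < s \<Longrightarrow> s \<le> 1 \<Longrightarrow> diff_bound s p (n + k) x M \<Longrightarrow>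
     js\<in>words k \<Longrightarrow> diff_bound s p n (word_gen js ((mollify 0 0 s ^^ k) x)) (C / s ^ k * M)" by metis
  obtain c where c: "\<And>js. js \<in> words (Suc k) \<Longrightarrow> c js \<ge> 0"
    "\<And>js s x. js \<in> words (Suc k) \<Longrightarrow> 0 < s \<Longrightarrow> s \<le> 1 \<Longrightarrow> word_smooth k x \<Longrightarrow> (\<exists>y. gen_word T js (mollify 0 0 s x) = Some y \<and>
     (\<forall>n M. (\<forall>js'\<in>words k. diff_bound s p (n + 1) (word_gen js' x) M) \<longrightarrow> diff_bound s p n y (c js / s * M)))"
    using mollify_word[of _ k 0 0 p] by metis
  let ?C = "\<Sum>js\<in>words (Suc k). c js"
  have C0: "?C \<ge> 0" using c(1) by (intro sum_nonneg) auto
  show ?case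
  proof (intro exI[of _ "?C * C"] conjI allI impI ballI)
    show "0 \<le> ?C * C" using C0 C(1) by simp
    fix s x n M js assume s: "0 < s" "s \<le> (1::real)" and M: "diff_bound s p (n + Suc k) x M" and js: "js \<in> words (Suc k)"
    let ?x = "(mollify 0 0 s ^^ k) x"
    obtain y where y: "gen_word T js (mollify 0 0 s ?x) = Some y"
      "\<And>n M. (\<forall>js'\<in>words k. diff_bound s p (n + 1) (word_gen js' ?x) M) \<Longrightarrow> diff_bound s p n y (c js / s * M)"
      using c(2)[OF js s word_smooth_mollify_power[OF s]] by blast
    have "\<forall>js'\<in>words k. diff_bound s p (n + 1) (word_gen js' ?x) (C / s ^ k * M)"
      using M by (intro ballI C(2)[OF s]) (simp_all add: One_nat_def)
    then have "diff_bound s p n y (c js / s * (C / s ^ k * M))" by (rule y(2))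
    moreover have "c js / s * (C / s ^ k * M) = c js * (C * M / s ^ Suc k)" by simp
    moreover have "\<dots> \<le> ?C * (C * M / s ^ Suc k)"
      using c(1) js C(1) diff_bound_nonneg[OF M] s by (intro mult_right_mono member_le_sum) auto
    moreover have "\<dots> = ?C * C / s ^ Suc k * M" by simp
    ultimately have "diff_bound s p n y (?C * C / s ^ Suc k * M)" by (metis diff_bound_mono)
    moreover have "word_gen js ((mollify 0 0 s ^^ Suc k) x) = y" using y(1) by (simp add: word_gen_def)
    ultimately show "diff_bound s p n (word_gen js ((mollify 0 0 s ^^ Suc k) x)) (?C * C / s ^ Suc k * M)" by simp
  qed
qed

section \<open>The operator I - P and the decomposition\<close>

definition mollify_err :: "real \<Rightarrow> 'a \<Rightarrow> 'a" where "mollify_err s x = x - mollify 0 0 s x"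

lemma diff_bound_mollify_err:
  assumes "diff_bound s p n x M" "0 < s" "s \<le> 1"
  shows "diff_bound s p n (mollify_err s x) ((1 + 144 ^ p) * M)"
  unfolding mollify_err_def distrib_right using diff_bound_diff[OF assms(1) diff_bound_mollify[OF assms]] by simp

text \<open>x minus its mean is minus the mean of the differences T_j(u)x - x; these sit innermost,
  so M is kept.\<close>

lemma diff_bound_minus_avg:
  assumes "diff_bound s p (n + 1) x M" "0 < s" "s \<le> 1"
  shows "diff_bound s p n (x - (1 / s) *\<^sub>R avg j (\<lambda>_. 1) s x) M"
proof -
  have "diff_bound s p n ((- 1 / s) *\<^sub>R integral {0..s} (\<lambda>u. S j u x - x)) (\<bar>- 1 / s\<bar> * ((s - 0) * M))"
    unfolding S_subgrp_elem using assms
    by (intro diff_bound_scale diff_bound_integral diff_bound_D[OF assms(1)] subgrp_elem_box)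
       (auto intro!: continuous_intros simp: S_subgrp_elem[symmetric])
  moreover have "integral {0..s} (\<lambda>u. S j u x - x) = integral {0..s} (\<lambda>u. S j u x) - integral {0..s} (\<lambda>u. x)"
    by (intro integral_diff integrable_continuous_real continuous_intros)
  ultimately show ?thesis using assms by (simp add: avg_def scaleR_diff_right)
qed

text \<open>With A_j here the mean over T_j: I - A_1 A_2 = (I - A_1) + A_1(I - A_2), where the outer
  A_1 costs 12^p.\<close>

lemma diff_bound_mollify_err_lower:
  assumes "diff_bound s p (n + 1) x M" "0 < s" "s \<le> 1"
  shows "diff_bound s p n (mollify_err s x) ((1 + 12 ^ p) * M)"
proof -
  have w: "exp_weight 0 = (\<lambda>_. 1)" "pow_weight 0 = (\<lambda>_. 1)" by (auto simp: exp_weight_def pow_weight_def)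
  let ?A = "\<lambda>j x. (1 / s) *\<^sub>R avg j (\<lambda>_. 1) s x"
  have "?A 1 x = ?A 1 (x - ?A 2 x) + ?A 1 (?A 2 x)"
    by (simp flip: scaleR_add_right avg_add)
  then have "mollify_err s x = (x - ?A 1 x) + ?A 1 (x - ?A 2 x)"
    by (simp add: mollify_err_def mollify_def w avg_scale power2_eq_square)
  moreover have "diff_bound s p n ((x - ?A 1 x) + ?A 1 (x - ?A 2 x)) (M + \<bar>1 / s\<bar> * (s * (12 ^ p * M)))"
    using assms by (intro diff_bound_add diff_bound_minus_avg diff_bound_scale diff_bound_avg) auto
  ultimately show ?thesis using assms by (simp add: distrib_right)
qed

lemma diff_bound_mollify_err_power:
  "0 < s \<Longrightarrow> s \<le> 1 \<Longrightarrow> diff_bound s p (n + k) x M \<Longrightarrow> diff_bound s p n ((mollify_err s ^^ k) x) ((1 + 12 ^ p) ^ k * M)"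
proof (induction k arbitrary: n)
  case (Suc k)
  then have "diff_bound s p (n + 1) ((mollify_err s ^^ k) x) ((1 + 12 ^ p) ^ k * M)"
    by (metis add.assoc add.commute plus_1_eq_Suc)
  from diff_bound_mollify_err_lower[OF this] Suc.prems show ?case by (simp add: mult.assoc)
qed simp

lemma mollify_mollify_err: "mollify 0 0 s (mollify_err s x) = mollify_err s (mollify 0 0 s x)"
  by (simp add: mollify_err_def mollify_diff)

lemma mollify_err_add: "mollify_err s (x + y) = mollify_err s x + mollify_err s y"
  by (simp add: mollify_err_def mollify_add)

lemma mollify_power_add:
  "(mollify 0 0 s ^^ m) (x + y) = (mollify 0 0 s ^^ m) x + (mollify 0 0 s ^^ m) y"
  by (induction m) (auto simp: mollify_add)

lemma mollify_err_power_add: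
  "(mollify_err s ^^ m) (x + y) = (mollify_err s ^^ m) x + (mollify_err s ^^ m) y"
  by (induction m) (auto simp: mollify_err_add)

lemma mollify_mollify_err_power:
  "mollify 0 0 s ((mollify_err s ^^ n) x) = (mollify_err s ^^ n) (mollify 0 0 s x)"
  by (induction n) (auto simp: mollify_mollify_err)

lemma mollify_err_mollify_power:
  "mollify_err s ((mollify 0 0 s ^^ n) x) = (mollify 0 0 s ^^ n) (mollify_err s x)"
  by (induction n) (auto simp: mollify_mollify_err[symmetric])

text \<open>Induction on m + n replaces the binomial expansion. In x = Px + (I-P)x, the
  decomposition for (m-1, n) is inserted into the first summand and that for (m, n-1) into the
  second; P and I-P commute, so the full powers come out in front. If m or n is 0, x itself is the
  corresponding piece.\<close>

lemma diff_bound_decomposition: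
  "\<exists>C>0. \<forall>s x q M. 0 < s \<longrightarrow> s \<le> 1 \<longrightarrow> diff_bound s p q x M \<longrightarrow>
    (\<exists>y z. x = (mollify 0 0 s ^^ m) y + (mollify_err s ^^ n) z \<and> diff_bound s p q y (C * M) \<and> diff_bound s p q z (C * M))"
proof (induction "m + n" arbitrary: m n)
  case 0
  have "x = (mollify 0 0 s ^^ m) x + (mollify_err s ^^ n) 0 \<and> diff_bound s p q x (1 * M) \<and> diff_bound s p q 0 (1 * M)"
    if "diff_bound s p q x M" "0 < s" for s x q M
    using 0 that diff_bound_mono[OF diff_bound_zero diff_bound_nonneg[OF that(1)]] by simp
  then show ?case by (intro exI[of _ 1] conjI allI impI) (auto, blast)
next
  case (Suc N)
  show ?case
  proof (cases "m = 0 \<or> n = 0")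
    case True
    have z: "diff_bound s p q 0 (1 * M)" if "diff_bound s p q x M" "0 < s" for s x q M
      using that diff_bound_mono[OF diff_bound_zero diff_bound_nonneg[OF that(1)]] by simp
    have "\<exists>y z. x = (mollify 0 0 s ^^ m) y + (mollify_err s ^^ n) z \<and> diff_bound s p q y (1 * M) \<and> diff_bound s p q z (1 * M)"
      if x: "diff_bound s p q x M" "0 < s" for s x q M
    proof (cases "m = 0")
      case True
      have "(mollify_err s ^^ n) 0 = 0" using mollify_err_power_add[of n s 0 0] by simp
      then show ?thesis using True x z[OF x] by (intro exI[of _ x] exI[of _ 0]) simp
    next
      case False
      then have "n = 0" using \<open>m = 0 \<or> n = 0\<close> by simp
      have "(mollify 0 0 s ^^ m) 0 = 0" using mollify_power_add[of m s 0 0] by simp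
      then show ?thesis using \<open>n = 0\<close> x z[OF x] by (intro exI[of _ 0] exI[of _ x]) simp
    qed
    then show ?thesis by (intro exI[of _ 1]) auto
  next
    case False
    then obtain m' n' where mn: "m = Suc m'" "n = Suc n'" by (meson not0_implies_Suc)
    have N: "N = m' + n" "N = m + n'" using Suc.hyps(2) mn by auto
    obtain C1 where C1: "C1 > 0" "\<And>s x q M. 0 < s \<Longrightarrow> s \<le> 1 \<Longrightarrow> diff_bound s p q x M \<Longrightarrow>
      (\<exists>y z. x = (mollify 0 0 s ^^ m') y + (mollify_err s ^^ n) z \<and> diff_bound s p q y (C1 * M) \<and> diff_bound s p q z (C1 * M))"
      using Suc.hyps(1)[OF N(1)] by blast
    obtain C2 where C2: "C2 > 0" "\<And>s x q M. 0 < s \<Longrightarrow> s \<le> 1 \<Longrightarrow> diff_bound s p q x M \<Longrightarrow>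
      (\<exists>y z. x = (mollify 0 0 s ^^ m) y + (mollify_err s ^^ n') z \<and> diff_bound s p q y (C2 * M) \<and> diff_bound s p q z (C2 * M))"
      using Suc.hyps(1)[OF N(2)] by blast
    let ?C = "(1 + 144 ^ p) * (C1 + C2)"
    show ?thesis
    proof (intro exI[of _ ?C] conjI allI impI)
      show "0 < ?C" using C1(1) C2(1) by (intro mult_pos_pos) (auto simp: add_pos_nonneg)
      fix s x q M assume s: "0 < s" "s \<le> (1::real)" and M: "diff_bound s p q x M"
      have M0: "0 \<le> M" using diff_bound_nonneg[OF M] s by simp
      obtain a b where ab: "x = (mollify 0 0 s ^^ m') a + (mollify_err s ^^ n) b" "diff_bound s p q a (C1 * M)" "diff_bound s p q b (C1 * M)"
        using C1(2)[OF s M] by blast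
      obtain c d where cd: "x = (mollify 0 0 s ^^ m) c + (mollify_err s ^^ n') d" "diff_bound s p q c (C2 * M)" "diff_bound s p q d (C2 * M)"
        using C2(2)[OF s M] by blast
      have "x = mollify 0 0 s x + mollify_err s x" by (simp add: mollify_err_def)
      also have "mollify 0 0 s x = (mollify 0 0 s ^^ m) a + (mollify_err s ^^ n) (mollify 0 0 s b)"
        by (subst ab(1)) (simp add: mollify_add mollify_mollify_err_power[of s n, unfolded mn] mn del: funpow.simps(2), simp)
      also have "mollify_err s x = (mollify 0 0 s ^^ m) (mollify_err s c) + (mollify_err s ^^ n) d"
        by (subst cd(1)) (simp add: mollify_err_add mollify_err_mollify_power[of s m, unfolded mn] mn del: funpow.simps(2), simp)
      finally have "x = (mollify 0 0 s ^^ m) (a + mollify_err s c) + (mollify_err s ^^ n) (mollify 0 0 s b + d)"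
        by (simp add: mollify_power_add mollify_err_power_add algebra_simps)
      moreover have "diff_bound s p q (a + mollify_err s c) (?C * M)"
      proof (rule diff_bound_mono[OF diff_bound_add[OF ab(2) diff_bound_mollify_err[OF cd(2) s]]])
        have "0 \<le> 144 ^ p * (C1 * M)" using C1 M0 by simp
        then show "C1 * M + (1 + 144 ^ p) * (C2 * M) \<le> ?C * M" by (simp add: algebra_simps)
      qed
      moreover have "diff_bound s p q (mollify 0 0 s b + d) (?C * M)"
      proof (rule diff_bound_mono[OF diff_bound_add[OF diff_bound_mollify[OF ab(3) s] cd(3)]])
        have "0 \<le> C1 * M + 144 ^ p * (C2 * M)" using C1 C2 M0 by simp
        then show "144 ^ p * (C1 * M) + C2 * M \<le> ?C * M" by (simp add: algebra_simps)
      qed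
      ultimately show "\<exists>y z. x = (mollify 0 0 s ^^ m) y + (mollify_err s ^^ n) z \<and> diff_bound s p q y (?C * M) \<and> diff_bound s p q z (?C * M)"
        by blast
    qed
  qed
qed

subsection \<open>Comparison of the modulus and the $K$-functional\<close>

lemma gen_word_zero: "gen_word T js 0 = Some 0"
proof (induction js)
  case (Cons j js) then show ?case unfolding gen_word_Cons_iff using gen_0 by blast
qed simp

lemma Er_norm_zero: "Er_norm T r 0 = 0"
  by (simp add: Er_norm_def gen_word_zero)

lemma zero_in_Er: "0 \<in> Er T r"
  by (simp add: Er_def gen_word_zero)

lemma norm_le_Er_norm: "norm x \<le> Er_norm T r x"
  unfolding Er_norm_def by (simp add: sum_nonneg)

lemma Er_norm_nonneg: "0 \<le> Er_norm T r x"
  using norm_le_Er_norm norm_ge_zero order_trans by blast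

lemma norm_word_gen_le_Er_norm:
  assumes "js \<in> words r" "r \<ge> 1" shows "norm (word_gen js x) \<le> Er_norm T r x"
proof -
  have "norm (word_gen js x) \<le> (\<Sum>js\<in>words r. norm (word_gen js x))"
    using assms by (intro member_le_sum) auto
  also have "\<dots> \<le> (\<Sum>k=1..r. \<Sum>js\<in>words k. norm (word_gen js x))"
    using assms by (intro member_le_sum[of r "{1..r}" "\<lambda>k. \<Sum>js\<in>words k. norm (word_gen js x)"]) (auto intro: sum_nonneg)
  finally show ?thesis
    unfolding Er_norm_def word_gen_def using norm_ge_zero[of x] by linarith
qed

lemma K_functional_le:
  assumes "x1 \<in> Er T r" "x = x0 + x1" "0 \<le> t"
  shows "K_functional T r t x \<le> norm x0 + t * Er_norm T r x1"
  unfolding K_functional_def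
  using assms by (intro cInf_lower bdd_belowI[of _ 0]) (auto simp: Er_norm_nonneg)

lemma le_K_functional:
  assumes "\<And>x0 x1. x1 \<in> Er T r \<Longrightarrow> x = x0 + x1 \<Longrightarrow> B \<le> norm x0 + t * Er_norm T r x1"
  shows "B \<le> K_functional T r t x"
  unfolding K_functional_def
proof (rule cInf_greatest)
  show "{norm x0 + t * Er_norm T r x1 | x0 x1. x1 \<in> Er T r \<and> x = x0 + x1} \<noteq> {}"
    using zero_in_Er[of r] add_0_right[of x, symmetric] by blast
qed (use assms in auto)

lemma K_functional_le_norm: "0 \<le> t \<Longrightarrow> K_functional T r t x \<le> norm x"
  using K_functional_le[OF zero_in_Er, of x x t] by (simp add: Er_norm_zero)

lemma diff_word_linear: "linear (diff_word T (zip js ts))"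
  unfolding diff_word_iter_diff by (intro bounded_linear.linear iter_diff_bl) (auto simp: set_zip)

lemma norm_diff_word: "norm (diff_word T ps x) \<le> 2 ^ length ps * norm x"
proof (induction ps)
  case (Cons p ps)
  obtain j t where p: "p = (j, t)" by (cases p)
  have "norm (diff_word T (p # ps) x) \<le> norm (S j t (diff_word T ps x)) + norm (diff_word T ps x)"
    by (simp add: p norm_triangle_ineq4)
  also have "\<dots> \<le> 2 * norm (diff_word T ps x)" using S_norm[of j t "diff_word T ps x"] by simp
  finally show ?case using Cons by simp
qed simp

abbreviation steps :: "nat \<Rightarrow> real \<Rightarrow> real list set" where
  "steps r s \<equiv> {ts. length ts = r \<and> set ts \<subseteq> {0..s}}"

lemma norm_diff_word_steps:
  "js \<in> words r \<Longrightarrow> ts \<in> steps r s \<Longrightarrow>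
    norm (diff_word T (zip js ts) x) \<le> 2 ^ r * norm x"
  using norm_diff_word[of "zip js ts" x] by (simp add: words_def)

lemma mixed_modulus_le:
  assumes "\<And>js ts. js \<in> words r \<Longrightarrow> ts \<in> steps r s \<Longrightarrow> norm (diff_word T (zip js ts) x) \<le> B" "0 \<le> s"
  shows "mixed_modulus T r s x \<le> real (card (words r)) * B"
proof -
  have "replicate r 0 \<in> steps r s" using assms(2) by auto
  then have "steps r s \<noteq> {}" by blast
  then show ?thesis
    unfolding mixed_modulus_def using assms(1) by (intro sum_bounded_above cSUP_least)
qed

text \<open>A real \<open>SUP\<close> is an upper bound only for a bounded family; contractivity
  supplies the bound 2^r ||x||.\<close>

lemma diff_word_le_mixed_modulus:
  assumes js: "js \<in> words r" and ts: "ts \<in> steps r s"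
  shows "norm (diff_word T (zip js ts) x) \<le> mixed_modulus T r s x"
proof -
  have up: "norm (diff_word T (zip js' ts) x) \<le> (SUP ts\<in>steps r s. norm (diff_word T (zip js' ts) x))"
    if "js' \<in> words r" for js'
    using norm_diff_word_steps[OF that, of _ s x] ts
    by (intro cSUP_upper bdd_aboveI2[where M = "2 ^ r * norm x"]) auto
  have "(SUP ts\<in>steps r s. norm (diff_word T (zip js ts) x)) \<le> mixed_modulus T r s x"
    unfolding mixed_modulus_def
    by (rule member_le_sum[OF js]) (use up in \<open>auto intro: order_trans[OF norm_ge_zero]\<close>)
  then show ?thesis using up[OF js] by linarith
qed

lemma mixed_modulus_nonneg:
  assumes "0 \<le> s" shows "0 \<le> mixed_modulus T r s x"
proof -
  have "replicate r 1 \<in> words r" "replicate r 0 \<in> steps r s" using assms by (auto simp: words_def)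
  from diff_word_le_mixed_modulus[OF this] show ?thesis using norm_ge_zero order_trans by blast
qed

text \<open>For an arbitrary splitting, contractivity handles x0 with factor 2^r and, for s \<le> 1,
  \<open>diff_bound_from_generators\<close> handles x1 with factor C s^r.\<close>

lemma mixed_modulus_le_K_functional:
  assumes r: "r \<ge> 1"
  shows "\<exists>c>0. \<forall>x. \<forall>s>0. c * mixed_modulus T r s x \<le> K_functional T r (s ^ r) x"
proof -
  obtain C where C: "C > 0" "\<And>s x M. 0 < s \<Longrightarrow> s \<le> 1 \<Longrightarrow> word_smooth r x \<Longrightarrow>
     (\<forall>js\<in>words r. norm (word_gen js x) \<le> M) \<Longrightarrow> diff_bound s r r x (C * s ^ r * M)"
    using diff_bound_from_generators[of r] by blast
  define D where "D = 2 ^ r + C"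
  have D: "D > 0" "2 ^ r \<le> D" "C \<le> D" using C(1) by (auto simp: D_def add_pos_pos)
  let ?N = "real (card (words r)) + 1"
  have main: "mixed_modulus T r s x \<le> ?N * D * (norm x0 + s ^ r * Er_norm T r x1)"
    if s: "s > 0" and x1: "x1 \<in> Er T r" and x: "x = x0 + x1" for s x x0 x1
  proof -
    let ?B = "D * (norm x0 + s ^ r * Er_norm T r x1)"
    have B: "0 \<le> ?B" using D s by (simp add: Er_norm_nonneg)
    have "mixed_modulus T r s x \<le> card (words r) * ?B"
    proof (rule mixed_modulus_le)
      fix js ts assume js: "js \<in> words r" and ts: "ts \<in> steps r s"
      show "norm (diff_word T (zip js ts) x) \<le> ?B"
      proof (cases "s \<le> 1")
        case True
        have "diff_bound s r r x1 (C * s ^ r * Er_norm T r x1)"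
          using s True x1 r by (intro C(2)) (auto simp: Er_iff norm_word_gen_le_Er_norm)
        moreover have "set (map2 subgrp_elem js ts) \<subseteq> box s (1 * s)"
          using ts by (auto simp: set_zip subset_iff intro!: subgrp_elem_box)
        ultimately have "norm (diff_word T (zip js ts) x1) \<le> C * s ^ r * Er_norm T r x1 * 1 ^ r"
          unfolding diff_word_iter_diff using js ts by (intro diff_boundD) (auto simp: words_def)
        moreover have "\<dots> \<le> D * (s ^ r * Er_norm T r x1)"
          using D(3) s Er_norm_nonneg by (simp add: mult.assoc mult_right_mono)
        moreover have "norm (diff_word T (zip js ts) x0) \<le> D * norm x0"
          using norm_diff_word_steps[OF js ts, of x0] mult_right_mono[OF D(2) norm_ge_zero[of x0]] by linarith
        moreover have "norm (diff_word T (zip js ts) x) \<le> norm (diff_word T (zip js ts) x0) + norm (diff_word T (zip js ts) x1)"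
          by (simp add: x linear_add[OF diff_word_linear] norm_triangle_ineq)
        ultimately show ?thesis by (simp add: distrib_left)
      next
        case False
        have "1 * Er_norm T r x1 \<le> s ^ r * Er_norm T r x1"
          using False by (intro mult_right_mono Er_norm_nonneg) auto
        then have "norm x \<le> norm x0 + s ^ r * Er_norm T r x1"
          using norm_triangle_ineq[of x0 x1] norm_le_Er_norm[of x1 r] x by simp
        then have "2 ^ r * norm x \<le> ?B" using D by (intro mult_mono) auto
        then show ?thesis using norm_diff_word_steps[OF js ts, of x] by linarith
      qed
    qed (use s in simp)
    also have "\<dots> \<le> ?N * ?B" using B by (intro mult_right_mono) auto
    finally show ?thesis by (simp add: mult.assoc)
  qed
  have N: "?N * D > 0" using D(1) by (intro mult_pos_pos) auto
  show ?thesis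
  proof (intro exI[of _ "1 / (?N * D)"] conjI allI impI le_K_functional)
    fix x x0 x1 and s :: real assume "s > 0" "x1 \<in> Er T r" "x = x0 + x1"
    from main[OF this] show "1 / (?N * D) * mixed_modulus T r s x \<le> norm x0 + s ^ r * Er_norm T r x1"
      using N by (simp add: divide_le_eq mult_ac)
  qed (use N in simp)
qed

lemma K_functional_le_mixed_modulus:
  "\<exists>C>0. \<forall>x. \<forall>s>0. K_functional T r (s ^ r) x \<le> C * (mixed_modulus T r s x + min (s ^ r) 1 * norm x)"
proof -
  obtain C1 where C1: "C1 > 0" "\<And>s x M. 0 < s \<Longrightarrow> s \<le> 1 \<Longrightarrow>
     (\<forall>js\<in>words r. \<forall>ts. length ts = r \<longrightarrow> set ts \<subseteq> {0..s} \<longrightarrow> norm (diff_word T (zip js ts) x) \<le> M) \<Longrightarrow>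
     diff_bound s r r x (C1 * M)" using diff_bound_from_differences[of r] by blast
  obtain C2 where C2: "C2 > 0" "\<And>s x q M. 0 < s \<Longrightarrow> s \<le> 1 \<Longrightarrow> diff_bound s r q x M \<Longrightarrow>
    (\<exists>y z. x = (mollify 0 0 s ^^ r) y + (mollify_err s ^^ r) z \<and> diff_bound s r q y (C2 * M) \<and> diff_bound s r q z (C2 * M))"
    using diff_bound_decomposition[where p = r and m = r and n = r] by blast
  obtain C3 where C3: "C3 \<ge> 0" "\<And>s x n M js. 0 < s \<Longrightarrow> s \<le> 1 \<Longrightarrow> diff_bound s r (n + r) x M \<Longrightarrow>
     js \<in> words r \<Longrightarrow> diff_bound s r n (word_gen js ((mollify 0 0 s ^^ r) x)) (C3 / s ^ r * M)"
    using diff_bound_mollify_power[where p = r and k = r] by metis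
  obtain C4 where C4: "C4 > 0" "\<And>x. word_smooth r x \<Longrightarrow> Er_norm T r x \<le> C4 * (norm x + (\<Sum>js\<in>words r. norm (word_gen js x)))"
    using Er_norm_le[of r] by blast
  define N where "N = real (card (words r))"
  define A where "A = (1 + 12 ^ r) ^ r * (C2 * C1)"
  \<comment> \<open>The 1 serves s > 1, the bare \<open>C4\<close> is the coefficient of s^r ||x||,
    and the rest dominates the coefficient of the modulus.\<close>
  define C where "C = 1 + A + C4 * (1 + A + N * (C3 * (C2 * C1)))"
  have A: "0 \<le> A" using C1 C2 by (simp add: A_def)
  have C0: "0 \<le> N * (C3 * (C2 * C1))" using C1 C2 C3 by (simp add: N_def)
  have C: "C \<ge> 1" using A C0 C4(1) by (simp add: C_def)
  have main: "K_functional T r (s ^ r) x \<le> C * (mixed_modulus T r s x + min (s ^ r) 1 * norm x)"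
    if s: "s > 0" for s x
  proof (cases "s \<le> 1")
    case False
    have m: "min (s ^ r) 1 = 1" using False by (intro min_absorb2 one_le_power) simp
    have "K_functional T r (s ^ r) x \<le> norm x" using s by (intro K_functional_le_norm) simp
    also have "\<dots> \<le> mixed_modulus T r s x + min (s ^ r) 1 * norm x"
      using mixed_modulus_nonneg[of s r x] s m by simp
    also have "\<dots> \<le> C * (mixed_modulus T r s x + min (s ^ r) 1 * norm x)"
      using mult_right_mono[OF C, of "mixed_modulus T r s x + min (s ^ r) 1 * norm x"] mixed_modulus_nonneg[of s r x] s m by simp
    finally show ?thesis .
  next
    case s1: True
    define \<Omega> where "\<Omega> = mixed_modulus T r s x"
    have \<Omega>: "0 \<le> \<Omega>" using s by (simp add: \<Omega>_def mixed_modulus_nonneg)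
    have sr: "0 < s ^ r" "s ^ r \<le> 1" using s s1 by (auto simp: power_le_one)
    have "diff_bound s r r x (C1 * \<Omega>)"
      unfolding \<Omega>_def by (intro C1(2) s s1 ballI allI impI diff_word_le_mixed_modulus) auto
    then obtain y z where yz: "x = (mollify 0 0 s ^^ r) y + (mollify_err s ^^ r) z"
      "diff_bound s r r y (C2 * (C1 * \<Omega>))" "diff_bound s r r z (C2 * (C1 * \<Omega>))" using C2(2)[OF s s1] by blast
    let ?f0 = "(mollify_err s ^^ r) z" and ?f1 = "(mollify 0 0 s ^^ r) y"
    \<comment> \<open>With no difference left, \<open>diff_bound\<close> at K = 1 is a bound on the
      norm.\<close>
    have norm0: "norm v \<le> M" if "diff_bound s r 0 v M" for v M
      using diff_boundD[OF that, of 1 "[]"] by simp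
    have word_smooth: "word_smooth r ?f1" by (rule word_smooth_mollify_power[OF s s1])
    have f0: "norm ?f0 \<le> A * \<Omega>"
      using norm0[OF diff_bound_mollify_err_power[OF s s1, of r 0 r z "C2 * (C1 * \<Omega>)"]] yz(3) by (simp add: A_def mult.assoc)
    \<comment> \<open>The bound goes through x because r-th differences of \<open>y\<close> do not
      control the size of \<open>y\<close>. Here ||x|| enters, later weighted by s^r.\<close>
    have "norm ?f1 = norm (x - ?f0)" by (simp add: yz(1))
    also have "\<dots> \<le> norm x + norm ?f0" by (rule norm_triangle_ineq4)
    finally have f1: "norm ?f1 \<le> norm x + A * \<Omega>" using f0 by linarith
    have "norm (word_gen js ?f1) \<le> C3 / s ^ r * (C2 * (C1 * \<Omega>))" if "js \<in> words r" for js
      using that yz(2) by (intro norm0 C3(2)[OF s s1]) simp_all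
    then have "(\<Sum>js\<in>words r. norm (word_gen js ?f1)) \<le> N * (C3 / s ^ r * (C2 * (C1 * \<Omega>)))"
      unfolding N_def by (rule sum_bounded_above)
    also have "\<dots> = N * (C3 * (C2 * C1)) * \<Omega> / s ^ r" by simp
    finally have word_gen: "(\<Sum>js\<in>words r. norm (word_gen js ?f1)) \<le> N * (C3 * (C2 * C1)) * \<Omega> / s ^ r" .
    have "Er_norm T r ?f1 \<le> C4 * (norm ?f1 + (\<Sum>js\<in>words r. norm (word_gen js ?f1)))" by (rule C4(2)[OF word_smooth])
    also have "\<dots> \<le> C4 * ((norm x + A * \<Omega>) + N * (C3 * (C2 * C1)) * \<Omega> / s ^ r)"
      using C4(1) f1 word_gen by (intro mult_left_mono add_mono) auto
    finally have "s ^ r * Er_norm T r ?f1 \<le> s ^ r * (C4 * ((norm x + A * \<Omega>) + N * (C3 * (C2 * C1)) * \<Omega> / s ^ r))"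
      using sr by (intro mult_left_mono) auto
    also have "\<dots> = C4 * (s ^ r * norm x + s ^ r * (A * \<Omega>) + N * (C3 * (C2 * C1)) * \<Omega>)"
      using s by (simp add: field_simps)
    also have "\<dots> \<le> C4 * (s ^ r * norm x + A * \<Omega> + N * (C3 * (C2 * C1)) * \<Omega>)"
      using C4(1) sr A \<Omega> by (intro mult_left_mono add_right_mono add_left_mono mult_left_le_one_le) auto
    finally have E: "s ^ r * Er_norm T r ?f1 \<le> C4 * (s ^ r * norm x + A * \<Omega> + N * (C3 * (C2 * C1)) * \<Omega>)" .
    have "K_functional T r (s ^ r) x \<le> norm ?f0 + s ^ r * Er_norm T r ?f1"
      using word_smooth yz(1) sr by (intro K_functional_le) (auto simp: Er_iff)
    also have "\<dots> \<le> A * \<Omega> + C4 * (s ^ r * norm x + A * \<Omega> + N * (C3 * (C2 * C1)) * \<Omega>)"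
      using f0 E by linarith
    also have "\<dots> = C4 * (s ^ r * norm x) + (A + C4 * (A + N * (C3 * (C2 * C1)))) * \<Omega>"
      by (simp add: algebra_simps)
    also have "\<dots> \<le> C * (s ^ r * norm x) + C * \<Omega>"
    proof (intro add_mono mult_right_mono)
      have "0 \<le> C4 * (A + N * (C3 * (C2 * C1)))" using C4(1) A C0 by simp
      then show "C4 \<le> C" using A by (simp add: C_def algebra_simps)
      show "A + C4 * (A + N * (C3 * (C2 * C1))) \<le> C" using C4(1) by (simp add: C_def algebra_simps)
    qed (use sr \<Omega> in auto)
    also have "\<dots> = C * (\<Omega> + min (s ^ r) 1 * norm x)" using sr by (simp add: algebra_simps)
    finally show ?thesis by (simp add: \<Omega>_def)
  qed
  show ?thesis
  proof (intro exI[of _ C] conjI allI impI)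
    show "0 < C" using C by simp
  qed (rule main)
qed

end

theorem mainTheorem2:
  fixes T :: "real \<times> real \<Rightarrow> 'a::banach \<Rightarrow> 'a" and r :: nat
  assumes "contr_rep T" and "r \<ge> 1"
  shows "\<exists>c>0. \<exists>C>0. \<forall>f. \<forall>s>0.
           c * mixed_modulus T r s f \<le> K_functional T r (s ^ r) f \<and>
           K_functional T r (s ^ r) f \<le> C * (mixed_modulus T r s f + min (s ^ r) 1 * norm f)"
proof -
  interpret axb_rep T by standard (rule assms)
  show ?thesis
    using mixed_modulus_le_K_functional[OF assms(2)] K_functional_le_mixed_modulus[of r] by metis
qed

end
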